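(* Let $(\mathbf{n}_\kappa)_{\kappa\ge 1}$ be a sequence of degree statistics such that $|\mathbf{n}_\kappa|\to\infty$ as $\kappa\to\infty$ and such that, for every $i\ge 0$, $p_i(\mathbf{n}_\kappa)\to p_i$ as $\kappa\to\infty$, where $\mathbf{p}=(p_i)_{i\ge 0}$ is a probability distribution on $\mathbb{N}_0$. For $\kappa\ge 1$ let $T_\kappa\in\mathbb{T}$, with $m_\kappa:=|T_\kappa|$, be such that as $\kappa\to\infty$, $$m_\kappa^2\,\pi_{\mathbf{p}(\mathbf{n}_\kappa)}(T_\kappa)\sum_{i\in\mathcal{D}(T_\kappa)}\frac{p_i(\mathbf{n}_{T_\kappa})^2}{p_i(\mathbf{n}_\kappa)}=o(1).$$ Then, as $\kappa\to\infty$: (i) If $|\mathbf{n}_\kappa|\,\pi_{\mathbf{p}(\mathbf{n}_\kappa)}(T_\kappa)\to\lambda$ for some $\lambda\in(0,\infty)$, then $N_{T_\kappa}(\mathcal{T}_{\mathbf{n}_\kappa})$ converges in distribution to $\mathrm{Po}(\lambda)$, with convergence of all moments. (ii) If $|\mathbf{n}_\kappa|\,\pi_{\mathbf{p}(\mathbf{n}_\kappa)}(T_\kappa)\to\infty$, then $$\frac{N_{T_\kappa}(\mathcal{T}_{\mathbf{n}_\kappa})-|\mathbf{n}_\kappa|\,\pi_{\mathbf{p}(\mathbf{n}_\kappa)}(T_\kappa)}{\sqrt{|\mathbf{n}_\kappa|\,\pi_{\mathbf{p}(\mathbf{n}_\kappa)}(T_\kappa)}}$$ converges in distribution to $\mathrm{N}(0,1)$,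 with convergence of mean and variance (to $0$ and $1$, respectively). Thus, in both cases, $$\mathbb{E}\bigl[N_{T_\kappa}(\mathcal{T}_{\mathbf{n}_\kappa})\bigr]\sim \mathrm{Var}\bigl[N_{T_\kappa}(\mathcal{T}_{\mathbf{n}_\kappa})\bigr]\sim|\mathbf{n}_\kappa|\,\pi_{\mathbf{p}(\mathbf{n}_\kappa)}(T_\kappa).$$
   Context: $\mathbb{N}_0=\{0,1,2,\dots\}$. $\mathbb{T}$ is the set of all finite rooted plane (ordered) trees (up to isomorphism of plane rooted trees); $|T|$ is the number of vertices of $T$, and $d_T(v)$ is the (out)degree, i.e. number of children, of $v\in T$. The degree statistic of $T$ is $\mathbf{n}_T=(n_T(i))_{i\ge 0}$ with $n_T(i)=\#\{v\in T: d_T(v)=i\}$, and $\mathcal{D}(T)=\{i\ge 0:n_T(i)>0\}$. A sequence $\mathbf{n}=(n(i))_{i\ge 0}$ of nonnegative integers is called a degree statistic if $\sum_{i\ge 0}n(i)=1+\sum_{i\ge 0}i\,n(i)<\infty$ (equivalently, it is the degree statistic of some tree). Put $|\mathbf{n}|=\sum_i n(i)$; the empirical degree distribution is $\mathbf{p}(\mathbf{n})=(p_i(\mathbf{n}))_{i\ge 0}$ with $p_i(\mathbf{n})=n(i)/|\mathbf{n}|$ (in particular $p_i(\mathbf{n}_T)=n_T(i)/|T|$). $\mathbb{T}_{\mathbf{n}}$ is the (finite) set of plane rooted trees with degree statistic $\mathbf{n}$, and $\mathcal{T}_{\mathbf{n}}$ is a uniformly random element of $\mathbb{T}_{\mathbf{n}}$.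 For $v\in T$, the fringe tree $T_v$ is the subtree of $T$ consisting of $v$ and all its descendants, rooted at $v$. For $T,T'\in\mathbb{T}$, $N_{T'}(T)=\#\{v\in T: T_v=T'\}$, where equality means isomorphism as plane rooted trees. For a probability distribution $\mathbf{p}$ on $\mathbb{N}_0$ and $T\in\mathbb{T}$, $\pi_{\mathbf{p}}(T)=\prod_{i\ge 0}p_i^{n_T(i)}$ (with $0^0=1$). $\mathrm{Po}(\lambda)$ is the Poisson distribution with mean $\lambda$; $\mathrm{N}(0,1)$ is the standard normal distribution. "Convergence of all moments" means that for every $r\in\mathbb{N}$ the $r$-th moment converges to the $r$-th moment of the limit. $a_\kappa\sim b_\kappa$ means $a_\kappa/b_\kappa\to 1$. *)

theory Defs
  imports "HOL-Probability.Probability" "HOL-Library.Landau_Symbols"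
begin

datatype plane_tree = Branch (children: "plane_tree list")

text \<open>Vertices are Ulam--Harris addresses: the list of child indices (counted from \<open>0\<close>)
  on the path from the root to the vertex.\<close>

primrec is_vertex :: "nat list \<Rightarrow> plane_tree \<Rightarrow> bool" where
  "is_vertex [] T \<longleftrightarrow> True"
| "is_vertex (i # v) T \<longleftrightarrow> i < length (children T) \<and> is_vertex v (children T ! i)"

definition vertices :: "plane_tree \<Rightarrow> nat list set" where
  "vertices T = {v. is_vertex v T}"

text \<open>Meaningful only when the address is a vertex of the tree.\<close>

primrec fringe :: "nat list \<Rightarrow> plane_tree \<Rightarrow> plane_tree" where
  "fringe [] T = T"
| "fringe (i # v) T = fringe v (children T ! i)"

definition tree_size :: "plane_tree \<Rightarrow> nat" where
  "tree_size T = card (vertices T)"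

definition outdeg :: "plane_tree \<Rightarrow> nat list \<Rightarrow> nat" where
  "outdeg T v = length (children (fringe v T))"

definition deg_stat :: "plane_tree \<Rightarrow> nat \<Rightarrow> nat" where
  "deg_stat T i = card {v \<in> vertices T. outdeg T v = i}"

definition degrees :: "plane_tree \<Rightarrow> nat set" where
  "degrees T = {i. deg_stat T i > 0}"

definition fringe_count :: "plane_tree \<Rightarrow> plane_tree \<Rightarrow> nat" where
  "fringe_count T' T = card {v \<in> vertices T. fringe v T = T'}"

text \<open>A series of natural numbers is finite iff it has finitely many nonzero terms, so
  finiteness of \<open>\<Sum>i. n i\<close> is expressed as finite support; the series are sums over the support.\<close>

definition stat_size :: "(nat \<Rightarrow> nat) \<Rightarrow> nat" where
  "stat_size n = (\<Sum>i | n i > 0. n i)"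

definition degree_statistic :: "(nat \<Rightarrow> nat) \<Rightarrow> bool" where
  "degree_statistic n \<longleftrightarrow>
     finite {i. n i > 0} \<and> stat_size n = 1 + (\<Sum>i | n i > 0. i * n i)"

definition emp_dist :: "(nat \<Rightarrow> nat) \<Rightarrow> nat \<Rightarrow> real" where
  "emp_dist n i = real (n i) / real (stat_size n)"

definition trees_with :: "(nat \<Rightarrow> nat) \<Rightarrow> plane_tree set" where
  "trees_with n = {T. deg_stat T = n}"

text \<open>Whenever \<open>degree_statistic n\<close> holds, \<open>trees_with n\<close> is finite and nonempty, so this is the
  uniform distribution.\<close>

definition random_tree :: "(nat \<Rightarrow> nat) \<Rightarrow> plane_tree pmf" where
  "random_tree n = pmf_of_set (trees_with n)"

text \<open>All factors with index outside \<open>degrees T\<close> have exponent \<open>0\<close>, hence equal \<open>1\<close>.\<close>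

definition tree_prob :: "(nat \<Rightarrow> real) \<Rightarrow> plane_tree \<Rightarrow> real" where
  "tree_prob p T = (\<Prod>i\<in>degrees T. p i ^ deg_stat T i)"

text \<open>The quantity \<open>|n| \<pi>\<^bsub>p(n)\<^esub>(T)\<close>.\<close>

definition fringe_scale :: "(nat \<Rightarrow> nat) \<Rightarrow> plane_tree \<Rightarrow> real" where
  "fringe_scale n T = real (stat_size n) * tree_prob (emp_dist n) T"

lemma vertices_unfold:
  "vertices T = insert [] (\<Union>i<length (children T). (#) i ` vertices (children T ! i))"
proof (rule set_eqI)
  fix v
  show "v \<in> vertices T \<longleftrightarrow>
    v \<in> insert [] (\<Union>i<length (children T). (#) i ` vertices (children T ! i))"
    by (cases v) (auto simp: vertices_def)
qed

lemma finite_vertices: "finite (vertices T)"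
proof (induction T)
  case (Branch ts)
  then show ?case by (subst vertices_unfold) auto
qed

lemma finite_degrees: "finite (degrees T)"
proof (rule finite_subset)
  show "degrees T \<subseteq> outdeg T ` vertices T"
    by (auto simp: degrees_def deg_stat_def card_gt_0_iff)
qed (simp add: finite_vertices)

end

theory Submission
  imports Defs "HOL-Real_Asymp.Real_Asymp"
begin

text \<open>
  Let \<open>X\<close> be the number of fringe trees of the random tree that equal \<open>T\<close>, let \<open>m = |T|\<close>,
  \<open>N = |n|\<close>, \<open>t\<^sub>i = n\<^sub>T(i)\<close>, and let \<open>s = N \<pi>(T)\<close>. Everything rests on an exact formula for the
  factorial moments of \<open>X\<close>: with \<open>(x)\<^sub>j = x (x - 1) \<dots> (x - j + 1)\<close>,
  \<open>E (X)\<^sub>q = (\<Prod>i. (n(i))\<^bsub>q t\<^sub>i\<^esub>) / (N - 1)\<^bsub>q (m - 1)\<^esub>\<close>.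
  It comes from a recursion: deleting the root of the first tree of a plane forest
  leaves a forest with one vertex less and the same other fringe trees, so the sum of \<open>X choose q\<close>
  over all forests with given degrees satisfies a linear recursion that a quotient of factorials
  solves (\<open>binom_occ_formula\<close>, \<open>factorial_moment\<close>). The case \<open>q = 0\<close> counts the trees.

  Division by \<open>s\<^sup>q\<close> leaves only factors \<open>1 - j / n(i)\<close> and \<open>1 - j / N\<close>. Hence
  \<open>E (X)\<^sub>q / s\<^sup>q = 1 + O(q\<^sup>2 \<epsilon>)\<close> with \<open>\<epsilon> = (\<Sum>i. t\<^sub>i\<^sup>2 / n(i))\<close>; the factors with \<open>N\<close> are covered because
  \<open>m\<^sup>2 / N \<le> \<epsilon>\<close> by Cauchy--Schwarz (\<open>scaled_factorial_moment_bounds\<close>). The smallness hypothesis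
  says exactly that \<open>s \<epsilon> \<rightarrow> 0\<close>. So the quotient tends to \<open>1\<close> uniformly over \<open>q = O(\<surd>s)\<close>, and with
  error \<open>o(1 / s)\<close> for each fixed \<open>q\<close>. The latter for \<open>q = 1, 2\<close> gives mean and variance.

  If \<open>s \<rightarrow> l\<close>, the factorial moments converge to the powers \<open>l\<^sup>q\<close>, which are those of \<open>Po(l)\<close>. The Poisson
  law has exponential moments, so it is determined by its moments, and convergence of moments implies
  convergence of characteristic functions (\<open>moments_converge_imp_char_converges\<close>).

  If \<open>s \<rightarrow> \<infinity>\<close>, moments are too coarse, but large factorial moments act as exponential test functions:
  for \<open>q \<sim> t \<surd>s\<close> and \<open>Z = (X - s) / \<surd>s\<close> the quantity \<open>(X)\<^sub>q / s\<^sup>q\<close> is close to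
  \<open>exp (t Z - t\<^sup>2 / 2)\<close> where \<open>Z\<close> is bounded, and its mass where \<open>Z\<close> is large is
  negligible. So every weak limit \<open>\<nu>\<close> of \<open>Z\<close> satisfies \<open>(\<integral>z. exp (t z) \<partial>\<nu>) = exp (t\<^sup>2 / 2)\<close> for all \<open>t > 0\<close>
  (\<open>positive_mgf_of_weak_limit\<close>), and this characterises the standard normal law
  (\<open>normal_unique_if_positive_mgf\<close>). The bound on the variance supplies tightness.
\<close>

section \<open>Counting plane forests and their marked fringe trees\<close>

text \<open>
  Tree size, degree statistic and fringe count are all instances, with \<open>Q\<close> respectively trivial,
  a condition on the outdegree of the root, and equality with \<open>T\<close>; one recursion over the children
  then serves all three.
\<close>
definition count_nodes :: "(plane_tree \<Rightarrow> bool) \<Rightarrow> plane_tree \<Rightarrow> nat" where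
  "count_nodes Q t = card {v \<in> vertices t. Q (fringe v t)}"

lemma count_nodes_Branch:
  "count_nodes Q (Branch ts) = of_bool (Q (Branch ts)) + (\<Sum>t\<leftarrow>ts. count_nodes Q t)"
proof -
  let ?B = "\<lambda>i. (#) i ` {v \<in> vertices (ts ! i). Q (fringe v (ts ! i))}"
  let ?A = "\<Union>i<length ts. ?B i"
  let ?R = "if Q (Branch ts) then {[]} else {} :: nat list set"
  have fin: "finite (?B i)" for i
    by (simp add: finite_vertices)
  have "{v \<in> vertices (Branch ts). Q (fringe v (Branch ts))} = ?R \<union> ?A"
    by (subst vertices_unfold) auto
  then have "count_nodes Q (Branch ts) = card ?R + card ?A"
    unfolding count_nodes_def by (subst card_Un_disjoint[symmetric]) (auto simp: fin)
  also have "card ?A = (\<Sum>i<length ts. card (?B i))"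
    by (rule card_UN_disjoint) (auto simp: fin)
  also have "\<dots> = (\<Sum>i<length ts. count_nodes Q (ts ! i))"
    by (intro sum.cong refl) (simp add: count_nodes_def card_image)
  also have "\<dots> = (\<Sum>t\<leftarrow>ts. count_nodes Q t)"
    by (simp add: sum_list_sum_nth atLeast0LessThan)
  finally show ?thesis by simp
qed

text \<open>
  The degree statistic as a multiset. In this form deleting a vertex is the removal of an element, and
  the forest recursion becomes an induction on the size.
\<close>
primrec degs :: "plane_tree \<Rightarrow> nat multiset" where
  "degs (Branch ts) = add_mset (length ts) (sum_list (map degs ts))"

lemma count_sum_list: "count (sum_list Ms) i = (\<Sum>M\<leftarrow>Ms. count M i)"
  by (induction Ms) auto

lemma count_degs: "count (degs t) i = deg_stat t i"
proof -
  have *: "deg_stat t i = count_nodes (\<lambda>u. length (children u) = i) t" for t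
    by (simp add: deg_stat_def count_nodes_def outdeg_def)
  show ?thesis
    unfolding *
  proof (induction t)
    case (Branch ts)
    then show ?case
      by (simp add: count_nodes_Branch count_sum_list comp_def cong: map_cong)
  qed
qed

lemma tree_size_eq: "tree_size t = size (degs t)"
proof -
  have *: "tree_size t = count_nodes (\<lambda>u. True) t" for t
    by (simp add: tree_size_def count_nodes_def)
  have sz: "size (sum_list Ms) = (\<Sum>M\<leftarrow>Ms. size M)" for Ms :: "nat multiset list"
    by (induction Ms) auto
  show ?thesis
    unfolding *
  proof (induction t)
    case (Branch ts)
    then show ?case
      by (simp add: count_nodes_Branch sz comp_def cong: map_cong)
  qed
qed

lemma fringe_count_Branch:
  "fringe_count T (Branch ts) = of_bool (Branch ts = T) + (\<Sum>t\<leftarrow>ts. fringe_count T t)"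
proof -
  have *: "fringe_count T t = count_nodes (\<lambda>u. u = T) t" for t
    by (simp add: fringe_count_def count_nodes_def)
  show ?thesis
    unfolding * by (rule count_nodes_Branch)
qed

text \<open>
  The degrees determine the number of trees (\<open>length_forests\<close>), so a single multiset describes the whole class.
\<close>
definition forests :: "nat multiset \<Rightarrow> plane_tree list set" where
  "forests M = {F. sum_list (map degs F) = M}"

text \<open>
  Every vertex except the root is a child of exactly one vertex.
\<close>
lemma size_degs: "size (degs t) = Suc (sum_mset (degs t))"
proof (induction t)
  case (Branch ts)
  have "size (sum_list (map degs ts)) = length ts + sum_mset (sum_list (map degs ts))"
    using Branch by (induction ts) auto
  then show ?case by simp
qed

lemma length_forests:
  assumes "F \<in> forests M"
  shows "length F + sum_mset M = size M"
proof -
  have "length F + sum_mset (sum_list (map degs F)) = size (sum_list (map degs F))"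
    by (induction F) (auto simp: size_degs)
  then show ?thesis
    using assms by (simp add: forests_def)
qed

lemma degs_nonempty [simp]: "degs t \<noteq> {#}"
  by (cases t) auto

lemma forests_empty [simp]: "forests {#} = {[]}"
proof -
  have "F \<in> forests {#} \<Longrightarrow> F = []" for F
    by (cases F) (auto simp: forests_def)
  then show ?thesis by (auto simp: forests_def)
qed

fun pop_root :: "plane_tree list \<Rightarrow> plane_tree list" where
  "pop_root [] = []"
| "pop_root (Branch ts # F) = ts @ F"

text \<open>
  The inverse of \<open>pop_root\<close>, given the outdegree \<open>i\<close> of the deleted root.
\<close>
definition push_root :: "nat \<Rightarrow> plane_tree list \<Rightarrow> plane_tree list" where
  "push_root i G = Branch (take i G) # drop i G"

lemma pop_push_root [simp]: "pop_root (push_root i G) = G"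
  by (simp add: push_root_def)

lemma push_root_in_forests:
  assumes "i \<in># M" "G \<in> forests (M - {#i#})" "i \<le> length G"
  shows "push_root i G \<in> forests M"
proof -
  have "sum_list (map degs (take i G)) + sum_list (map degs (drop i G)) = sum_list (map degs G)"
    by (metis append_take_drop_id map_append sum_list_append)
  then show ?thesis
    using assms by (simp add: forests_def push_root_def)
qed

text \<open>
  Deleting the first root, of outdegree \<open>i\<close>, maps the nonempty forests bijectively to the pairs of
  \<open>i\<close> and a forest with the degree \<open>i\<close> removed. Every such forest \<open>G\<close> arises, since it has \<open>l - 1 + i \<ge> i\<close>
  trees and so its first \<open>i\<close> trees can be reattached.
\<close>
lemma forests_rec:
  assumes M: "M \<noteq> {#}" and l: "l + sum_mset M = size M" "l > 0"
  shows "forests M = (\<Union>i\<in>set_mset M. push_root i ` forests (M - {#i#}))"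
    and "\<And>i. i \<in># M \<Longrightarrow> inj_on (push_root i) (forests (M - {#i#}))"
    and "\<And>i j. i \<in># M \<Longrightarrow> j \<in># M \<Longrightarrow> i \<noteq> j \<Longrightarrow>
           push_root i ` forests (M - {#i#}) \<inter> push_root j ` forests (M - {#j#}) = {}"
proof -
  have len: "i \<le> length G" if iM: "i \<in># M" and G: "G \<in> forests (M - {#i#})" for i G
  proof -
    obtain M' where M': "M = add_mset i M'"
      using multi_member_split[OF iM] by blast
    show ?thesis
      using length_forests[OF G] l by (simp add: M')
  qed
  show "forests M = (\<Union>i\<in>set_mset M. push_root i ` forests (M - {#i#}))"
  proof (intro equalityI subsetI)
    fix F assume F: "F \<in> forests M"
    have "F \<noteq> []"
      using F M by (auto simp: forests_def)
    then obtain ts F' where [simp]: "F = Branch ts # F'"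
      by (cases F rule: pop_root.cases) auto
    have "M = add_mset (length ts) (sum_list (map degs (ts @ F')))"
      using F by (simp add: forests_def)
    moreover have "F = push_root (length ts) (ts @ F')"
      by (simp add: push_root_def)
    ultimately show "F \<in> (\<Union>i\<in>set_mset M. push_root i ` forests (M - {#i#}))"
      by (intro UN_I[of "length ts"] image_eqI[of _ _ "ts @ F'"]) (auto simp: forests_def)
  next
    fix F assume "F \<in> (\<Union>i\<in>set_mset M. push_root i ` forests (M - {#i#}))"
    then show "F \<in> forests M"
      using push_root_in_forests len by blast
  qed
  show "inj_on (push_root i) (forests (M - {#i#}))" for i
    by (rule inj_on_inverseI[where g = pop_root]) simp
  show "push_root i ` forests (M - {#i#}) \<inter> push_root j ` forests (M - {#j#}) = {}"
    if "i \<in># M" "j \<in># M" "i \<noteq> j" for i j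
  proof -
    have False if "G \<in> forests (M - {#i#})" "H \<in> forests (M - {#j#})" "push_root i G = push_root j H"
      for G H
    proof -
      have "length (take i G) = length (take j H)"
        using that(3) by (simp add: push_root_def)
      then show False
        using len[OF \<open>i \<in># M\<close> that(1)] len[OF \<open>j \<in># M\<close> that(2)] \<open>i \<noteq> j\<close> by simp
    qed
    then show ?thesis by blast
  qed
qed

lemma forests_eq_empty:
  assumes "M \<noteq> {#}" "size M \<le> sum_mset M"
  shows "forests M = {}"
proof -
  have False if "F \<in> forests M" for F
  proof -
    have "F = []"
      using length_forests[OF that] assms(2) by (metis add_le_same_cancel2 le_zero_eq length_0_conv)
    then show False
      using that assms by (simp add: forests_def)
  qed
  then show ?thesis by blast
qed

lemma finite_forests: "finite (forests M)"
proof (induction "size M" arbitrary: M)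
  case 0
  then show ?case by simp
next
  case (Suc k)
  show ?case
  proof (cases "size M \<le> sum_mset M")
    case True
    then show ?thesis
      using Suc by (subst forests_eq_empty) auto
  next
    case False
    then have "forests M = (\<Union>i\<in>set_mset M. push_root i ` forests (M - {#i#}))"
      using Suc by (intro forests_rec(1)[where l = "size M - sum_mset M"]) auto
    moreover have "finite (forests (M - {#i#}))" if "i \<in># M" for i
      using Suc that by (simp add: size_Diff_singleton)
    ultimately show ?thesis by auto
  qed
qed

lemma sum_forests_rec:
  fixes f :: "plane_tree list \<Rightarrow> 'a::comm_monoid_add"
  assumes M: "M \<noteq> {#}" and l: "l + sum_mset M = size M" "l > 0"
  shows "(\<Sum>F\<in>forests M. f (pop_root F)) = (\<Sum>i\<in>set_mset M. \<Sum>G\<in>forests (M - {#i#}). f G)"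
proof -
  have "(\<Sum>F\<in>forests M. f (pop_root F))
      = (\<Sum>i\<in>set_mset M. \<Sum>F\<in>push_root i ` forests (M - {#i#}). f (pop_root F))"
    unfolding forests_rec(1)[OF assms]
    by (rule sum.UNION_disjoint) (auto simp: finite_forests forests_rec(3)[OF assms])
  also have "\<dots> = (\<Sum>i\<in>set_mset M. \<Sum>G\<in>forests (M - {#i#}). f G)"
    by (rule sum.cong[OF refl]) (simp add: sum.reindex[OF forests_rec(2)[OF assms]])
  finally show ?thesis .
qed

definition occ :: "plane_tree \<Rightarrow> plane_tree list \<Rightarrow> nat" where
  "occ T F = (\<Sum>t\<leftarrow>F. fringe_count T t)"

text \<open>
  The fringe trees at all vertices other than the deleted root are unchanged.
\<close>
lemma occ_pop_root:
  assumes "F \<noteq> []"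
  shows "occ T F = of_bool (hd F = T) + occ T (pop_root F)"
  using assms by (cases F rule: pop_root.cases) (auto simp: occ_def fringe_count_Branch)

lemma degs_subset_sum_list:
  assumes "t \<in> set ts"
  shows "degs t \<subseteq># sum_list (map degs ts)"
proof -
  obtain xs ys where "ts = xs @ t # ys"
    using assms by (meson split_list)
  then show ?thesis
    by (simp add: subset_mset.add_increasing)
qed

lemma degs_subset_if_fringe_count:
  "fringe_count T t > 0 \<Longrightarrow> degs T \<subseteq># degs t"
proof (induction t)
  case (Branch ts)
  show ?case
  proof (cases "Branch ts = T")
    case False
    have "fringe_count T (Branch ts) \<noteq> 0"
      using Branch.prems by simp
    then obtain t where t: "t \<in> set ts" "fringe_count T t > 0"
      using False by (auto simp: fringe_count_Branch)
    then have "degs T \<subseteq># degs t"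
      using Branch.IH by blast
    also have "degs t \<subseteq># sum_list (map degs ts)"
      using t(1) by (rule degs_subset_sum_list)
    also have "\<dots> \<subseteq># degs (Branch ts)"
      by simp
    finally show ?thesis .
  qed simp
qed

text \<open>
  A proper fringe tree is smaller than the whole, so occurrences of \<open>T\<close> never nest.
\<close>
lemma occ_children: "occ T (children T) = 0"
proof -
  have "fringe_count T t = 0" if t: "t \<in> set (children T)" for t
  proof (rule ccontr)
    assume "fringe_count T t \<noteq> 0"
    then have "degs T \<subseteq># degs t"
      by (simp add: degs_subset_if_fringe_count)
    moreover have "degs t \<subseteq># sum_list (map degs (children T))"
      using t by (rule degs_subset_sum_list)
    ultimately have "degs T \<subseteq># sum_list (map degs (children T))"
      by (rule subset_mset.order_trans)
    moreover have "degs T = add_mset (length (children T)) (sum_list (map degs (children T)))"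
      by (cases T) simp
    ultimately show False
      using size_mset_mono by fastforce
  qed
  then show ?thesis
    by (simp add: occ_def)
qed

text \<open>
  Counts the pairs of a forest with degrees \<open>M\<close> and a set of \<open>q\<close> marked occurrences of \<open>T\<close>.
\<close>
definition binom_occ :: "plane_tree \<Rightarrow> nat \<Rightarrow> nat multiset \<Rightarrow> nat" where
  "binom_occ T q M = (\<Sum>F\<in>forests M. occ T F choose q)"

text \<open>
  Pascal's rule applied to \<open>occ_pop_root\<close>. The extra term comes from the forests that start with
  \<open>T\<close>; the children of \<open>T\<close> contain no occurrence, so the whole first tree can be dropped.
\<close>
lemma binom_occ_rec:
  assumes M: "M \<noteq> {#}" and l: "l + sum_mset M = size M" "l > 0"
  shows "binom_occ T 0 M = (\<Sum>i\<in>set_mset M. binom_occ T 0 (M - {#i#}))"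
    and "binom_occ T (Suc q) M = (\<Sum>i\<in>set_mset M. binom_occ T (Suc q) (M - {#i#}))
           + (if degs T \<subseteq># M then binom_occ T q (M - degs T) else 0)"
proof -
  show "binom_occ T 0 M = (\<Sum>i\<in>set_mset M. binom_occ T 0 (M - {#i#}))"
    using sum_forests_rec[OF assms, of "\<lambda>_. 1::nat"] by (simp add: binom_occ_def)
  have ne: "F \<noteq> []" if "F \<in> forests M" for F
    using that M by (auto simp: forests_def)
  have "binom_occ T (Suc q) M = (\<Sum>F\<in>forests M. (occ T (pop_root F) choose Suc q)
      + (if hd F = T then occ T (pop_root F) choose q else 0))"
    unfolding binom_occ_def by (intro sum.cong refl) (simp add: occ_pop_root[OF ne])
  also have "\<dots> = (\<Sum>F\<in>forests M. occ T (pop_root F) choose Suc q)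
      + (\<Sum>F\<in>{F\<in>forests M. hd F = T}. occ T (pop_root F) choose q)"
    by (simp add: sum.distrib sum.If_cases finite_forests Int_def)
  also have "(\<Sum>F\<in>forests M. occ T (pop_root F) choose Suc q)
      = (\<Sum>i\<in>set_mset M. binom_occ T (Suc q) (M - {#i#}))"
    unfolding binom_occ_def by (rule sum_forests_rec[OF assms])
  also have "(\<Sum>F\<in>{F\<in>forests M. hd F = T}. occ T (pop_root F) choose q)
      = (if degs T \<subseteq># M then binom_occ T q (M - degs T) else 0)"
  proof (cases "degs T \<subseteq># M")
    case True
    \<comment> \<open>After removing \<open>T\<close>, the remaining forest is unrestricted.\<close>
    have "{F\<in>forests M. hd F = T} = (#) T ` forests (M - degs T)"
    proof (intro equalityI subsetI)
      fix F assume F: "F \<in> {F\<in>forests M. hd F = T}"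
      then obtain F' where "F = T # F'"
        using ne by (metis (mono_tags, lifting) list.collapse mem_Collect_eq)
      then show "F \<in> (#) T ` forests (M - degs T)"
        using F by (auto simp: forests_def)
    qed (use True in \<open>auto simp: forests_def\<close>)
    moreover have "occ T (pop_root (T # F)) = occ T F" for F
      using occ_children[of T] by (cases T) (simp add: occ_def)
    ultimately show ?thesis
      using True by (simp add: sum.reindex binom_occ_def)
  next
    case False
    have none: "{F\<in>forests M. hd F = T} = {}"
    proof -
      have "degs T \<subseteq># M" if "F \<in> forests M" "hd F = T" for F
        using that ne[OF that(1)] by (cases F) (auto simp: forests_def)
      then show ?thesis
        using False by blast
    qed
    show ?thesis
      unfolding none using False by simp
  qed
  finally show "binom_occ T (Suc q) M = (\<Sum>i\<in>set_mset M. binom_occ T (Suc q) (M - {#i#}))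
           + (if degs T \<subseteq># M then binom_occ T q (M - degs T) else 0)" .
qed


text \<open>
  The denominator of a multinomial coefficient.
\<close>
definition mfact :: "nat multiset \<Rightarrow> real" where
  "mfact R = (\<Prod>i\<in>set_mset R. fact (count R i))"

lemma mfact_pos: "mfact R > 0"
  by (simp add: mfact_def prod_pos)

lemma mfact_superset:
  assumes "finite S" "set_mset R \<subseteq> S"
  shows "mfact R = (\<Prod>i\<in>S. fact (count R i))"
  unfolding mfact_def using assms by (intro prod.mono_neutral_left) (auto simp: not_in_iff)

lemma mfact_remove:
  assumes "i \<in># R"
  shows "mfact R = count R i * mfact (R - {#i#})"
proof -
  have "mfact (R - {#i#}) = (\<Prod>j\<in>set_mset R. fact (count (R - {#i#}) j))"
    by (rule mfact_superset) (auto dest: in_diffD)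
  also have "\<dots> = fact (count R i - 1) * (\<Prod>j\<in>set_mset R - {i}. fact (count R j))"
    using assms by (subst prod.remove[of _ i]) auto
  finally have *: "mfact (R - {#i#}) = fact (count R i - 1) * (\<Prod>j\<in>set_mset R - {i}. fact (count R j))" .
  have "mfact R = fact (count R i) * (\<Prod>j\<in>set_mset R - {i}. fact (count R j))"
    unfolding mfact_def using assms by (subst prod.remove[of _ i]) auto
  moreover have "fact (count R i) = real (count R i) * fact (count R i - 1)"
    using assms by (intro fact_reduce) simp
  ultimately show ?thesis
    using * by simp
qed

lemma sum_mset_eq_sum:
  fixes R :: "nat multiset"
  assumes "finite S" "set_mset R \<subseteq> S"
  shows "sum_mset R = (\<Sum>i\<in>S. count R i * i)"
  using assms(2)
proof (induction R)
  case (add x R)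
  have "(\<Sum>i\<in>S. count (add_mset x R) i * i) = (\<Sum>i\<in>S. count R i * i + (if i = x then x else 0))"
    by (intro sum.cong refl) auto
  then show ?case
    using add assms(1) by (simp add: sum.distrib)
qed simp

text \<open>
  Occurrences are disjoint, so \<open>q\<close> of them use up \<open>q\<close> copies of the degrees of \<open>T\<close>. The recursion
  gives this directly.
\<close>
lemma binom_occ_eq_0: "\<not> repeat_mset q (degs T) \<subseteq># M \<Longrightarrow> binom_occ T q M = 0"
proof (induction "size M" arbitrary: M q rule: less_induct)
  case less
  obtain q' where q: "q = Suc q'"
    using less.prems by (cases q) auto
  consider "M = {#}" | "M \<noteq> {#}" "size M \<le> sum_mset M" | "M \<noteq> {#}" "size M > sum_mset M"
    by linarith
  then show ?case
  proof cases
    case 1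
    then show ?thesis by (simp add: binom_occ_def q occ_def)
  next
    case 2
    then show ?thesis by (simp add: binom_occ_def forests_eq_empty)
  next
    case 3
    have "binom_occ T q (M - {#i#}) = 0" if "i \<in># M" for i
    proof (rule less.hyps)
      show "size (M - {#i#}) < size M"
        using that by (simp add: size_Diff1_less)
      show "\<not> repeat_mset q (degs T) \<subseteq># M - {#i#}"
        using less.prems by (meson diff_subset_eq_self subset_mset.order_trans)
    qed
    moreover have "binom_occ T q' (M - degs T) = 0" if D: "degs T \<subseteq># M"
    proof (rule less.hyps)
      show "size (M - degs T) < size M"
        using D 3 by (simp add: size_Diff_submset size_degs)
      show "\<not> repeat_mset q' (degs T) \<subseteq># M - degs T"
        using less.prems D unfolding q
        by (metis repeat_mset_Suc subset_mset.add_le_cancel_left subset_mset.add_diff_inverse)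
    qed
    ultimately show ?thesis
      using binom_occ_rec(2)[of M "size M - sum_mset M" T q'] 3 by (simp add: q)
  qed
qed

text \<open>
  Contracting the \<open>q\<close> marked occurrences to leaves suggests the formula: it is the number of forests of \<open>l\<close>
  trees with \<open>size R + q\<close> vertices, of which \<open>q\<close> are indistinguishable marked leaves and the others have
  the degrees \<open>R\<close>. The proof is an induction on the size of \<open>M\<close> along \<open>binom_occ_rec\<close>: with
  \<open>c = size R + q - 2\<close> and up to the common divisor \<open>q! mfact R\<close>, removing \<open>i\<close> from \<open>R\<close>
  contributes \<open>c! (l - 1 + i) count R i\<close>, marking the first tree contributes \<open>c! q (l - 1)\<close>, and these add up to \<open>c! (c + 1) l\<close> because \<open>l + sum_mset R = size R + q\<close>.
\<close>
lemma binom_occ_formula: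
  assumes "M = repeat_mset q (degs T) + R" "M \<noteq> {#}" "l + sum_mset M = size M"
  shows "real (binom_occ T q M) * (fact q * mfact R) = real l * fact (size R + q - 1)"
  using assms
proof (induction "size M" arbitrary: M q R l rule: less_induct)
  case less
  note M = less.prems(1) and ne = less.prems(2) and l = less.prems(3)
  let ?D = "degs T"
  show ?case
  proof (cases "l = 0")
    case True
    then show ?thesis
      using less.prems by (simp add: binom_occ_def forests_eq_empty)
  next
    case False
    \<comment> \<open>The term of the recursion in which the first tree is a marked copy of \<open>T\<close>.\<close>
    define rest where "rest = (if q > 0 then binom_occ T (q - 1) (M - ?D) else 0)"
    have rec: "binom_occ T q M = (\<Sum>i\<in>set_mset M. binom_occ T q (M - {#i#})) + rest"
    proof (cases q)
      case 0
      then show ?thesis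
        using binom_occ_rec(1)[OF ne l, of T] False by (simp add: rest_def)
    next
      case (Suc q')
      then show ?thesis
        using binom_occ_rec(2)[OF ne l, of T q'] False M by (simp add: rest_def)
    qed
    \<comment> \<open>All copies of such an \<open>i\<close> are needed for the \<open>q\<close> occurrences of \<open>T\<close>.\<close>
    have "binom_occ T q (M - {#i#}) = 0" if "i \<in># M" "i \<notin># R" for i
    proof (rule binom_occ_eq_0)
      have "count M i = q * count ?D i"
        using that(2) by (simp add: M not_in_iff)
      moreover have "count (M - {#i#}) i < count M i"
        using that(1) by simp
      ultimately show "\<not> repeat_mset q ?D \<subseteq># M - {#i#}"
        by (metis count_repeat_mset leD mset_subset_eq_count)
    qed
    then have "(\<Sum>i\<in>set_mset M. binom_occ T q (M - {#i#})) = (\<Sum>i\<in>set_mset R. binom_occ T q (M - {#i#}))"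
      by (intro sum.mono_neutral_right) (auto simp: M)
    then have rec': "binom_occ T q M = (\<Sum>i\<in>set_mset R. binom_occ T q (M - {#i#})) + rest"
      using rec by simp
    have sizeM: "size M = q * size ?D + size R" and sumM: "sum_mset M = q * sum_mset ?D + sum_mset R"
    proof -
      show "size M = q * size ?D + size R"
        by (simp add: M)
      have "sum_mset (repeat_mset q ?D) = q * sum_mset ?D"
        by (induction q) auto
      then show "sum_mset M = q * sum_mset ?D + sum_mset R"
        by (simp add: M)
    qed
    have sumR: "l + sum_mset R = size R + q"
      using l unfolding sizeM sumM size_degs by (simp add: algebra_simps)
    show ?thesis
    proof (cases "size R + q \<ge> 2")
      case True
      define c where "c = size R + q - 2"
      have step: "real (binom_occ T q (M - {#i#})) * (fact q * mfact R)
          = fact c * ((real l - 1) * count R i + real (count R i * i))" if "i \<in># R" for i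
      proof -
        have eq: "M - {#i#} = repeat_mset q ?D + (R - {#i#})"
          using that by (simp add: M)
        have ne': "M - {#i#} \<noteq> {#}"
        proof
          assume "M - {#i#} = {#}"
          then have "R - {#i#} = {#}" "q = 0"
            using eq by (auto simp: repeat_mset_eq_empty_iff)
          then show False
            using True size_Suc_Diff1[OF that] by simp
        qed
        have iM: "i \<in># M"
          using that M by simp
        have "(l - 1 + i) + sum_mset (M - {#i#}) = size (M - {#i#})"
        proof -
          obtain M' where "M = add_mset i M'"
            using multi_member_split[OF iM] by blast
          then show ?thesis
            using l False by simp
        qed
        from less.hyps[OF _ eq ne' this]
        have "real (binom_occ T q (M - {#i#})) * (fact q * mfact (R - {#i#}))
           = real (l - 1 + i) * fact (size (R - {#i#}) + q - 1)"
          using iM by (simp add: size_Diff1_less)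
        moreover have "size (R - {#i#}) + q - 1 = c"
          using size_Suc_Diff1[OF that] by (simp add: c_def)
        ultimately have IH: "real (binom_occ T q (M - {#i#})) * (fact q * mfact (R - {#i#}))
            = (real l - 1 + real i) * fact c"
          using False by (simp add: of_nat_diff)
        have "real (binom_occ T q (M - {#i#})) * (fact q * mfact R)
            = count R i * (real (binom_occ T q (M - {#i#})) * (fact q * mfact (R - {#i#})))"
          by (simp add: mfact_remove[OF that])
        also have "\<dots> = fact c * ((real l - 1) * count R i + real (count R i * i))"
          unfolding IH by (simp add: algebra_simps)
        finally show ?thesis .
      qed
      have rest: "real rest * (fact q * mfact R) = q * ((real l - 1) * fact c)"
      proof (cases q)
        case 0
        then show ?thesis by (simp add: rest_def)
      next
        case (Suc q')
        have eq: "M - ?D = repeat_mset q' ?D + R"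
          by (simp add: M Suc)
        have ne': "M - ?D \<noteq> {#}"
          using True by (auto simp: eq Suc repeat_mset_eq_empty_iff)
        have "(l - 1) + sum_mset (M - ?D) = size (M - ?D)"
        proof -
          have "M = ?D + (M - ?D)"
            by (simp add: M Suc)
          then have "size M = size ?D + size (M - ?D)" "sum_mset M = sum_mset ?D + sum_mset (M - ?D)"
            by (metis size_union, metis sum_mset.union)
          then show ?thesis
            using l False by (simp add: size_degs)
        qed
        moreover have "size (M - ?D) < size M"
          by (simp add: M Suc nonempty_has_size[symmetric])
        ultimately have "real (binom_occ T q' (M - ?D)) * (fact q' * mfact R)
            = real (l - 1) * fact (size R + q' - 1)"
          using less.hyps[OF _ eq ne'] by blast
        moreover have "size R + q' - 1 = c"
          by (simp add: c_def Suc)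
        ultimately have IH: "real (binom_occ T q' (M - ?D)) * (fact q' * mfact R) = (real l - 1) * fact c"
          using False by (simp add: of_nat_diff)
        have "real rest * (fact q * mfact R) = q * (real (binom_occ T q' (M - ?D)) * (fact q' * mfact R))"
          by (simp add: rest_def Suc)
        then show ?thesis
          unfolding IH .
      qed
      have "real (binom_occ T q M) * (fact q * mfact R)
          = (\<Sum>i\<in>set_mset R. fact c * ((real l - 1) * count R i + real (count R i * i)))
             + q * ((real l - 1) * fact c)"
        using step rest by (simp add: rec' distrib_right sum_distrib_right)
      also have "(\<Sum>i\<in>set_mset R. fact c * ((real l - 1) * count R i + real (count R i * i)))
          = fact c * ((real l - 1) * size R + sum_mset R)"
        unfolding sum_mset_eq_sum[OF finite_set_mset order_refl] size_multiset_overloaded_eq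
        by (simp add: sum.distrib flip: sum_distrib_left)
      also have "real (sum_mset R) = real (size R) + real q - real l"
        using sumR by linarith
      also have "fact c * ((real l - 1) * size R + (real (size R) + real q - real l)) + q * ((real l - 1) * fact c)
          = real l * (real (size R + q - 1) * fact c)"
        using True by (simp add: algebra_simps of_nat_diff)
      also have "real (size R + q - 1) * fact c = fact (size R + q - 1)"
        using True unfolding c_def by (subst (2) fact_reduce) (auto simp: numeral_2_eq_2)
      finally show ?thesis .
    next
      \<comment> \<open>Here removing one degree, or one copy of \<open>T\<close>, may leave the empty forest, which the formula does not cover.\<close>
      case small: False
      have pos: "size R + q \<noteq> 0"
        using ne M by (auto simp: repeat_mset_eq_empty_iff)
      then have "size R + q = Suc 0"
        using small by linarith
      then consider "q = 0" "size R = 1" | "q = 1" "R = {#}"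
        unfolding add_is_1 by auto
      then show ?thesis
      proof cases
        case 1
        then obtain a where a: "R = {#a#}"
          using size_1_singleton_mset by blast
        have "a = 0" "l = 1"
          using 1 sumR False by (auto simp: a)
        then show ?thesis
          using rec' 1 by (simp add: a M binom_occ_def rest_def mfact_def)
      next
        case 2
        then have "l = 1"
          using sumR False by simp
        then show ?thesis
          using rec' 2 by (simp add: M binom_occ_def rest_def mfact_def)
      qed
    qed
  qed
qed

section \<open>Factorial moments of the number of fringe trees\<close>

text \<open>
  The falling factorial \<open>x (x - 1) \<dots> (x - q + 1)\<close> divided by \<open>s\<^sup>q\<close>, the order of its expectation when \<open>x\<close> has
  mean about \<open>s\<close>.
\<close>
definition scaled_ffact :: "real \<Rightarrow> nat \<Rightarrow> nat \<Rightarrow> real" where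
  "scaled_ffact s q x = fact q * real (x choose q) / s ^ q"

lemma scaled_ffact_nonneg: "s > 0 \<Longrightarrow> scaled_ffact s q x \<ge> 0"
  by (simp add: scaled_ffact_def)

lemma scaled_ffact_eq_prod: "scaled_ffact s q x = (\<Prod>j<q. (real x - real j) / s)"
proof -
  have "fact q * real (x choose q) = (\<Prod>j<q. real x - real j)"
    by (simp add: binomial_gbinomial gbinomial_mult_fact atLeast0LessThan)
  then show ?thesis
    by (simp add: scaled_ffact_def prod_dividef)
qed

lemma fact_eq_prod_falling:
  assumes "a \<le> k"
  shows "fact k = fact (k - a) * (\<Prod>j<a. real k - real j)"
  using assms
proof (induction a)
  case (Suc a)
  have "fact (k - a) = (real k - real a) * fact (k - Suc a)"
  proof -
    have "k - a = Suc (k - Suc a)"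
      using Suc.prems by simp
    then have "fact (k - a) = real (Suc (k - Suc a)) * (fact (k - Suc a) :: real)"
      by (metis fact_Suc of_nat_fact of_nat_mult)
    also have "real (Suc (k - Suc a)) = real k - real a"
      using Suc.prems by (simp add: of_nat_diff)
    finally show ?thesis .
  qed
  then show ?case
    using Suc by (simp add: mult_ac)
qed simp

text \<open>
  Both kinds of factors that remain after scaling fit here: \<open>x j = j / n(i)\<close> and \<open>x j = (j + 1) / N\<close>.
\<close>
lemma prod_one_minus_bounds:
  fixes x :: "nat \<Rightarrow> real"
  assumes N: "N > 0" and x: "\<And>j. j < a \<Longrightarrow> 0 \<le> x j \<and> x j \<le> 1 \<and> x j \<le> (real j + 1) / N"
  shows "1 - (real a)\<^sup>2 / N \<le> (\<Prod>j<a. 1 - x j)" "(\<Prod>j<a. 1 - x j) \<le> 1"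
proof -
  have "(\<Sum>j<a. x j) \<le> (\<Sum>j<a. real a / N)"
  proof (rule sum_mono)
    fix j assume "j \<in> {..<a}"
    then show "x j \<le> real a / N"
      using N by (intro order_trans[OF conjunct2[OF conjunct2[OF x]]] divide_right_mono) auto
  qed
  also have "\<dots> = (real a)\<^sup>2 / N"
    by (simp add: power2_eq_square)
  finally have "1 - (real a)\<^sup>2 / N \<le> 1 - (\<Sum>j<a. x j)"
    by simp
  also have "\<dots> \<le> (\<Prod>j<a. 1 - x j)"
    using x by (intro Weierstrass_prod_ineq) auto
  finally show "1 - (real a)\<^sup>2 / N \<le> (\<Prod>j<a. 1 - x j)" .
  show "(\<Prod>j<a. 1 - x j) \<le> 1"
    using x by (intro prod_le_1) auto
qed

lemma mfact_ratio:
  assumes "M = repeat_mset q D + R"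
  shows "mfact M = mfact R * (\<Prod>i\<in>set_mset M. \<Prod>j<q * count D i. real (count M i) - real j)"
proof -
  have "mfact M = (\<Prod>i\<in>set_mset M. fact (count R i) * (\<Prod>j<q * count D i. real (count M i) - real j))"
    unfolding mfact_def
  proof (rule prod.cong[OF refl])
    fix i
    show "fact (count M i) = fact (count R i) * (\<Prod>j<q * count D i. real (count M i) - real j)"
      using fact_eq_prod_falling[of "q * count D i" "count M i"] by (simp add: assms)
  qed
  also have "\<dots> = mfact R * (\<Prod>i\<in>set_mset M. \<Prod>j<q * count D i. real (count M i) - real j)"
    unfolding prod.distrib by (subst mfact_superset[of "set_mset M" R]) (auto simp: assms)
  finally show ?thesis .
qed

lemma trees_with_count: "trees_with (count M) = {t. degs t = M}"
  by (auto simp: trees_with_def multiset_eq_iff count_degs fun_eq_iff)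

lemma forests_single:
  assumes "size M = Suc (sum_mset M)"
  shows "forests M = (\<lambda>t. [t]) ` trees_with (count M)"
proof (intro equalityI subsetI)
  fix F assume F: "F \<in> forests M"
  then have "length F = Suc 0"
    using length_forests[OF F] assms by simp
  then obtain t where "F = [t]"
    by (auto simp: length_Suc_conv)
  then show "F \<in> (\<lambda>t. [t]) ` trees_with (count M)"
    using F by (simp add: trees_with_count forests_def)
qed (auto simp: trees_with_count forests_def)

lemma binom_occ_single:
  assumes "size M = Suc (sum_mset M)"
  shows "binom_occ T q M = (\<Sum>t\<in>trees_with (count M). fringe_count T t choose q)"
  unfolding binom_occ_def forests_single[OF assms] by (subst sum.reindex) (auto simp: inj_on_def occ_def)

text \<open>
  A sum over an empty set vanishes, so the counting formula itself shows that trees exist.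
\<close>
lemma trees_with_finite_nonempty:
  assumes "size M = Suc (sum_mset M)"
  shows "finite (trees_with (count M))" "trees_with (count M) \<noteq> {}"
proof -
  have "real (binom_occ undefined 0 M) * (fact 0 * mfact M) = real 1 * fact (size M + 0 - 1)"
    using assms by (intro binom_occ_formula) auto
  then have "binom_occ undefined 0 M \<noteq> 0"
    by (metis fact_nonzero mult_1 mult_eq_0_iff of_nat_0 of_nat_1)
  then show "trees_with (count M) \<noteq> {}"
    by (auto simp: binom_occ_single[OF assms])
  have "finite ((\<lambda>t. [t]) ` trees_with (count M))"
    using finite_forests[of M] by (simp add: forests_single[OF assms])
  then show "finite (trees_with (count M))"
    by (rule finite_imageD) (simp add: inj_on_def)
qed

text \<open>
  The ratio of \<open>binom_occ_formula\<close> for \<open>q\<close> and for \<open>0\<close>, with a single tree.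
\<close>
lemma factorial_moment:
  assumes sz: "size M = Suc (sum_mset M)" and M: "M = repeat_mset q (degs T) + R"
  shows "measure_pmf.expectation (random_tree (count M)) (\<lambda>t. fact q * real (fringe_count T t choose q))
    = fact (size R + q - 1) / fact (size M - 1)
        * (\<Prod>i\<in>set_mset M. \<Prod>j<q * count (degs T) i. real (count M i) - real j)"
proof -
  let ?S = "trees_with (count M)"
  have fin: "finite ?S" "?S \<noteq> {}"
    using trees_with_finite_nonempty[OF sz] by auto
  have ne: "M \<noteq> {#}"
    using sz by auto
  have "measure_pmf.expectation (random_tree (count M)) (\<lambda>t. fact q * real (fringe_count T t choose q))
      = (\<Sum>t\<in>?S. fact q * real (fringe_count T t choose q)) / card ?S"
    unfolding random_tree_def using fin by (intro integral_pmf_of_set)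
  also have "(\<Sum>t\<in>?S. fact q * real (fringe_count T t choose q)) = fact q * real (binom_occ T q M)"
    by (simp add: binom_occ_single[OF sz] sum_distrib_left)
  also have "real (card ?S) = real (binom_occ T 0 M)"
    by (simp add: binom_occ_single[OF sz])
  also have "real (binom_occ T 0 M) = fact (size M - 1) / mfact M"
    using binom_occ_formula[of M 0 T M 1] ne sz mfact_pos[of M] by (simp add: field_simps)
  also have "fact q * real (binom_occ T q M) = fact (size R + q - 1) / mfact R"
    using binom_occ_formula[OF M ne, of 1] sz mfact_pos[of R] by (simp add: field_simps)
  also have "fact (size R + q - 1) / mfact R / (fact (size M - 1) / mfact M)
      = fact (size R + q - 1) / fact (size M - 1) * (mfact M / mfact R)"
    by simp
  also have "mfact M / mfact R = (\<Prod>i\<in>set_mset M. \<Prod>j<q * count (degs T) i. real (count M i) - real j)"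
    using mfact_pos[of R] by (subst mfact_ratio[OF M]) simp
  finally show ?thesis .
qed

lemma stat_size_count: "stat_size (count M) = size M"
  by (simp add: stat_size_def set_mset_def[symmetric] size_multiset_overloaded_eq)

lemma degrees_eq: "degrees T = set_mset (degs T)"
  by (simp add: degrees_def set_mset_def count_degs)

text \<open>
  With \<open>m = size (degs T)\<close>, the denominator \<open>(N - 1) (N - 2) \<dots> (N - a)\<close> of the factorial moment has \<open>a = q (m - 1)\<close>
  factors, and \<open>s\<^sup>q\<close> contains the power \<open>q - q m = - a\<close> of \<open>N\<close>; so all powers of \<open>N\<close> and of the \<open>n(i)\<close> cancel.
\<close>
lemma scaled_factorial_moment_eq:
  assumes sz: "size M = Suc (sum_mset M)" and M: "M = repeat_mset q (degs T) + R" and q: "q > 0"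
  defines "N \<equiv> real (size M)" and "a \<equiv> q * (size (degs T) - 1)"
  shows "measure_pmf.expectation (random_tree (count M))
      (\<lambda>t. scaled_ffact (fringe_scale (count M) T) q (fringe_count T t))
    = (\<Prod>i\<in>set_mset M. \<Prod>j<q * count (degs T) i. 1 - real j / count M i) / (\<Prod>j<a. 1 - (real j + 1) / N)"
proof -
  let ?D = "degs T"
  let ?E = "\<Prod>i\<in>set_mset M. real (count M i) ^ (q * count ?D i)"
  let ?rho = "\<Prod>i\<in>set_mset M. \<Prod>j<q * count ?D i. 1 - real j / count M i"
  let ?sigma = "\<Prod>j<a. 1 - (real j + 1) / N"
  have N: "N > 0"
    by (simp only: N_def sz of_nat_0_less_iff zero_less_Suc)
  have sub: "set_mset ?D \<subseteq> set_mset M"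
    using q by (auto simp: M count_greater_zero_iff[symmetric] simp del: count_greater_zero_iff)
  have m: "size ?D \<ge> 1"
    by (simp add: size_degs)
  have sizeM: "size M = q * size ?D + size R"
    by (simp add: M)
  have qm: "q * size ?D = a + q"
    using m by (simp add: a_def algebra_simps)
  have a: "a \<le> size M - 1" "size R + q - 1 = size M - 1 - a"
    using q sizeM qm by auto
  have fac: "(\<Prod>i\<in>set_mset M. \<Prod>j<q * count ?D i. real (count M i) - real j) = ?E * ?rho"
  proof -
    have "(\<Prod>j<b. x - real j) = x ^ b * (\<Prod>j<b. 1 - real j / x)" if "x > 0" for x b
    proof -
      have "(\<Prod>j<b. x - real j) = (\<Prod>j<b. x * (1 - real j / x))"
        using that by (intro prod.cong refl) (simp add: right_diff_distrib)
      then show ?thesis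
        by (simp add: prod.distrib)
    qed
    then show ?thesis
      by (simp add: prod.distrib[symmetric])
  qed
  have "fact (size M - 1) = fact (size M - 1 - a) * (\<Prod>j<a. real (size M - 1) - real j)"
    by (rule fact_eq_prod_falling[OF a(1)])
  also have "(\<Prod>j<a. real (size M - 1) - real j) = (\<Prod>j<a. N * (1 - (real j + 1) / N))"
    using N sz by (intro prod.cong refl) (simp add: N_def field_simps)
  also have "\<dots> = N ^ a * ?sigma"
    by (simp add: prod.distrib)
  finally have den: "fact (size M - 1) = fact (size R + q - 1) * (N ^ a * ?sigma)"
    unfolding a(2) .
  have scale: "fringe_scale (count M) T ^ q = ?E / N ^ a"
  proof -
    have "tree_prob (emp_dist (count M)) T = (\<Prod>i\<in>set_mset ?D. (real (count M i) / N) ^ count ?D i)"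
      by (simp add: tree_prob_def degrees_eq emp_dist_def stat_size_count N_def count_degs)
    also have "\<dots> = (\<Prod>i\<in>set_mset M. (real (count M i) / N) ^ count ?D i)"
      using sub by (intro prod.mono_neutral_left) (auto simp: not_in_iff)
    finally have "tree_prob (emp_dist (count M)) T ^ q = (\<Prod>i\<in>set_mset M. (real (count M i) / N) ^ (q * count ?D i))"
      by (simp add: prod_power_distrib power_mult[symmetric] mult.commute)
    also have "\<dots> = ?E / N ^ (\<Sum>i\<in>set_mset M. q * count ?D i)"
      by (simp add: power_divide prod_dividef power_sum)
    also have "(\<Sum>i\<in>set_mset M. q * count ?D i) = q * size ?D"
    proof -
      have "size ?D = (\<Sum>i\<in>set_mset M. count ?D i)"
        unfolding size_multiset_overloaded_eq using sub
        by (intro sum.mono_neutral_left) (auto simp: not_in_iff)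
      then show ?thesis
        by (simp add: sum_distrib_left)
    qed
    finally have "fringe_scale (count M) T ^ q = N ^ q * (?E / N ^ (a + q))"
      by (simp add: fringe_scale_def power_mult_distrib stat_size_count N_def qm)
    then show ?thesis
      using N by (simp add: power_add)
  qed
  have "measure_pmf.expectation (random_tree (count M))
      (\<lambda>t. scaled_ffact (fringe_scale (count M) T) q (fringe_count T t))
     = fact (size R + q - 1) / fact (size M - 1) * (?E * ?rho) / fringe_scale (count M) T ^ q"
    unfolding scaled_ffact_def using factorial_moment[OF sz M] by (simp add: fac)
  also have "\<dots> = ?rho / ?sigma"
  proof -
    have "F / (F * (A * S)) * (E * r) / (E / A) = r / S" if "F \<noteq> 0" "A \<noteq> 0" "E \<noteq> 0" for F A S E r :: real
      using that by (simp add: field_simps)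
    moreover have "?E \<noteq> 0" "N ^ a \<noteq> 0"
      using N by auto
    ultimately show ?thesis
      unfolding den scale by simp
  qed
  finally show ?thesis .
qed

text \<open>
  This is \<open>\<epsilon>\<close>: the factorial moment of order \<open>q\<close> deviates from the power \<open>s\<^sup>q\<close> by a relative error of order \<open>q\<^sup>2 \<epsilon>\<close>.
\<close>
definition rel_overlap :: "(nat \<Rightarrow> nat) \<Rightarrow> plane_tree \<Rightarrow> real" where
  "rel_overlap n T = (\<Sum>i\<in>degrees T. (real (deg_stat T i))\<^sup>2 / real (n i))"

lemma rel_overlap_nonneg: "rel_overlap n T \<ge> 0"
  unfolding rel_overlap_def by (intro sum_nonneg) simp

lemma size_le_rel_overlap:
  assumes sub: "set_mset (degs T) \<subseteq> set_mset M"
  shows "(real (size (degs T)))\<^sup>2 / size M \<le> rel_overlap (count M) T"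
proof -
  let ?D = "degs T"
  have M: "size M > 0"
    using sub by (cases "M = {#}") (auto simp: nonempty_has_size)
  have "(real (size ?D))\<^sup>2 = (\<Sum>i\<in>set_mset ?D. (real (count ?D i) / sqrt (count M i)) * sqrt (count M i))\<^sup>2"
  proof -
    have "real (count M i) > 0" if "i \<in># ?D" for i
      using sub that by auto
    then show ?thesis
      by (simp add: size_multiset_overloaded_eq)
  qed
  also have "\<dots> \<le> (\<Sum>i\<in>set_mset ?D. (real (count ?D i) / sqrt (count M i))\<^sup>2) * (\<Sum>i\<in>set_mset ?D. (sqrt (count M i))\<^sup>2)"
    by (rule Cauchy_Schwarz_ineq_sum)
  also have "(\<Sum>i\<in>set_mset ?D. (real (count ?D i) / sqrt (count M i))\<^sup>2) = rel_overlap (count M) T"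
    by (simp add: rel_overlap_def degrees_eq power_divide count_degs)
  also have "(\<Sum>i\<in>set_mset ?D. (sqrt (count M i))\<^sup>2) \<le> size M"
  proof -
    have "(\<Sum>i\<in>set_mset ?D. count M i) \<le> (\<Sum>i\<in>set_mset M. count M i)"
      using sub by (intro sum_mono2) auto
    then show ?thesis
      by (simp add: size_multiset_overloaded_eq flip: of_nat_sum)
  qed
  finally show ?thesis
    using M rel_overlap_nonneg[of "count M" T] by (simp add: pos_divide_le_eq mult_left_mono)
qed

text \<open>
  The numerator of \<open>scaled_factorial_moment_eq\<close> and its denominator both lie between \<open>1 - \<eta>\<close> and \<open>1\<close>, where
  \<open>\<eta> = q\<^sup>2 \<epsilon>\<close>.
\<close>
lemma scaled_factorial_moment_bounds:
  assumes sz: "size M = Suc (sum_mset M)" and sub: "set_mset (degs T) \<subseteq> set_mset M"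
    and small: "(real q)\<^sup>2 * rel_overlap (count M) T \<le> 1 / 2"
  shows "\<bar>measure_pmf.expectation (random_tree (count M))
      (\<lambda>t. scaled_ffact (fringe_scale (count M) T) q (fringe_count T t)) - 1\<bar>
    \<le> 2 * ((real q)\<^sup>2 * rel_overlap (count M) T)"
proof (cases "q = 0")
  case True
  then show ?thesis by (simp add: scaled_ffact_def)
next
  case False
  let ?D = "degs T"
  let ?n = "count M"
  define \<eta> where "\<eta> = (real q)\<^sup>2 * rel_overlap (count M) T"
  define N where "N = real (size M)"
  define a where "a = q * (size ?D - 1)"
  have N: "N > 0"
    by (simp only: N_def sz of_nat_0_less_iff zero_less_Suc)
  have eta: "\<eta> = (\<Sum>i\<in>set_mset ?D. (real (q * count ?D i))\<^sup>2 / ?n i)"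
    by (simp add: \<eta>_def rel_overlap_def degrees_eq count_degs sum_distrib_left power_mult_distrib)
  \<comment> \<open>A single term \<open>(q t\<^sub>i)\<^sup>2 / n(i)\<close> below \<open>1\<close> already forces \<open>q t\<^sub>i \<le> n(i)\<close>: the degrees suffice for \<open>q\<close> copies of \<open>T\<close>.\<close>
  have le: "q * count ?D i \<le> ?n i" for i
  proof (cases "i \<in># ?D")
    case True
    then have n: "?n i > 0"
      using sub by auto
    have "(real (q * count ?D i))\<^sup>2 / ?n i \<le> \<eta>"
      unfolding eta using True by (intro member_le_sum) auto
    also have "\<eta> < 1"
      using small by (simp add: \<eta>_def)
    finally have "(real (q * count ?D i))\<^sup>2 < real (?n i)"
      using n by simp
    then have "(q * count ?D i)\<^sup>2 < ?n i"
      by (metis of_nat_less_iff of_nat_power)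
    then show ?thesis
      by (metis le_trans less_imp_le power2_nat_le_imp_le order_refl power2_eq_square le_square)
  next
    case False
    then show ?thesis by (simp add: not_in_iff)
  qed
  define R where "R = M - repeat_mset q ?D"
  have M: "M = repeat_mset q ?D + R"
    using le by (auto simp: R_def subseteq_mset_def)
  let ?rho = "\<Prod>i\<in>set_mset M. \<Prod>j<q * count ?D i. 1 - real j / ?n i"
  let ?sigma = "\<Prod>j<a. 1 - (real j + 1) / N"
  have E: "measure_pmf.expectation (random_tree (count M))
      (\<lambda>t. scaled_ffact (fringe_scale (count M) T) q (fringe_count T t)) = ?rho / ?sigma"
    using scaled_factorial_moment_eq[OF sz M] False unfolding a_def N_def by simp
  have fac: "1 - (real (q * count ?D i))\<^sup>2 / ?n i \<le> (\<Prod>j<q * count ?D i. 1 - real j / ?n i)"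
       "(\<Prod>j<q * count ?D i. 1 - real j / ?n i) \<le> 1"
       "0 \<le> (\<Prod>j<q * count ?D i. 1 - real j / ?n i)" if "i \<in># M" for i
  proof -
    have n: "real (?n i) > 0"
      using that by simp
    have x: "0 \<le> real j / ?n i \<and> real j / ?n i \<le> 1 \<and> real j / ?n i \<le> (real j + 1) / ?n i"
      if "j < q * count ?D i" for j
      using that le[of i] n by (simp add: divide_right_mono)
    show "1 - (real (q * count ?D i))\<^sup>2 / ?n i \<le> (\<Prod>j<q * count ?D i. 1 - real j / ?n i)"
      by (rule prod_one_minus_bounds(1)[OF n x])
    show "(\<Prod>j<q * count ?D i. 1 - real j / ?n i) \<le> 1"
      by (rule prod_one_minus_bounds(2)[OF n x])
    show "0 \<le> (\<Prod>j<q * count ?D i. 1 - real j / ?n i)"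
      using x by (intro prod_nonneg) auto
  qed
  have rho_le: "?rho \<le> 1"
    using fac by (intro prod_le_1) auto
  have rho_ge: "1 - \<eta> \<le> ?rho"
  proof -
    have "(\<Sum>i\<in>set_mset M. 1 - (\<Prod>j<q * count ?D i. 1 - real j / ?n i))
        \<le> (\<Sum>i\<in>set_mset M. (real (q * count ?D i))\<^sup>2 / ?n i)"
      using fac(1) by (intro sum_mono) (simp add: algebra_simps)
    also have "\<dots> = \<eta>"
      unfolding eta using sub by (intro sum.mono_neutral_right) (auto simp: not_in_iff)
    finally have "1 - \<eta> \<le> 1 - (\<Sum>i\<in>set_mset M. 1 - (\<Prod>j<q * count ?D i. 1 - real j / ?n i))"
      by simp
    also have "\<dots> \<le> (\<Prod>i\<in>set_mset M. 1 - (1 - (\<Prod>j<q * count ?D i. 1 - real j / ?n i)))"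
      using fac(2,3) by (intro Weierstrass_prod_ineq) auto
    finally show ?thesis by simp
  qed
  have sizeM: "size M = q * size ?D + size R"
    by (simp add: M)
  have aM: "a \<le> size M" "a \<le> q * size ?D"
    by (auto simp: sizeM a_def algebra_simps)
  have x: "0 \<le> (real j + 1) / N \<and> (real j + 1) / N \<le> 1 \<and> (real j + 1) / N \<le> (real j + 1) / N"
    if "j < a" for j
    using that aM N by (simp add: N_def)
  have sigma_le: "?sigma \<le> 1"
    by (rule prod_one_minus_bounds(2)[OF N x])
  have sigma_ge: "1 - \<eta> \<le> ?sigma"
  proof -
    have "(real a)\<^sup>2 / N \<le> (real (q * size ?D))\<^sup>2 / N"
      using aM N by (intro divide_right_mono power_mono) (auto simp del: of_nat_mult)
    also have "\<dots> = (real q)\<^sup>2 * ((real (size ?D))\<^sup>2 / size M)"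
      by (simp add: power_mult_distrib N_def)
    also have "\<dots> \<le> \<eta>"
      unfolding \<eta>_def by (intro mult_left_mono size_le_rel_overlap sub) simp
    finally have "1 - \<eta> \<le> 1 - (real a)\<^sup>2 / N" by simp
    also have "\<dots> \<le> ?sigma"
      by (rule prod_one_minus_bounds(1)[OF N x])
    finally show ?thesis .
  qed
  have eta_bounds: "0 \<le> \<eta>" "\<eta> \<le> 1 / 2"
    using small rel_overlap_nonneg by (auto simp: \<eta>_def)
  have sigma_pos: "?sigma > 0"
    using sigma_ge eta_bounds by linarith
  have "1 - \<eta> \<le> ?rho / ?sigma"
  proof -
    have "(1 - \<eta>) * ?sigma \<le> (1 - \<eta>) * 1"
      using sigma_le eta_bounds by (intro mult_left_mono) auto
    then show ?thesis
      using rho_ge sigma_pos by (simp add: pos_le_divide_eq)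
  qed
  moreover have "?rho / ?sigma \<le> 1 + 2 * \<eta>"
  proof -
    \<comment> \<open>This is where \<open>\<eta> \<le> 1 / 2\<close> is used.\<close>
    have "1 \<le> (1 + 2 * \<eta>) * (1 - \<eta>)"
      using eta_bounds mult_mono[of \<eta> "1 / 2" \<eta> \<eta>] by (simp add: algebra_simps)
    also have "\<dots> \<le> (1 + 2 * \<eta>) * ?sigma"
      using sigma_ge eta_bounds by (intro mult_left_mono) auto
    finally show ?thesis
      using rho_le sigma_pos by (simp add: pos_divide_le_eq)
  qed
  ultimately show ?thesis
    unfolding E \<eta>_def[symmetric] using eta_bounds by (simp add: abs_le_iff)
qed

section \<open>Moments, moment generating functions and characteristic functions\<close>

text \<open>
  If the coefficients below \<open>n\<close> vanish, division by \<open>y\<^sup>n\<close> leaves a series that vanishes for \<open>y \<noteq> 0\<close> and whose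
  limit at \<open>0\<close> is the coefficient \<open>n\<close>.
\<close>
lemma powser_eq_0_imp_coeff_eq_0:
  fixes a :: "nat \<Rightarrow> real"
  assumes r: "r > 0" and sums: "\<And>y. \<bar>y\<bar> < r \<Longrightarrow> (\<lambda>n. a n * y ^ n) sums 0"
  shows "a n = 0"
proof (induction n rule: less_induct)
  case (less n)
  have shifted: "(\<lambda>j. a (j + n) * y ^ j) sums 0" if "y \<noteq> 0" "\<bar>y\<bar> < r" for y
  proof -
    have "(\<lambda>j. a (j + n) * y ^ (j + n)) sums (0 - (\<Sum>j<n. a j * y ^ j))"
      using sums[OF that(2)] by (subst sums_iff_shift) simp
    then have "(\<lambda>j. (a (j + n) * y ^ (j + n)) / y ^ n) sums ((0 - (\<Sum>j<n. a j * y ^ j)) / y ^ n)"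
      by (rule sums_divide)
    then show ?thesis
      using that(1) less.IH by (simp add: power_add)
  qed
  have "((\<lambda>_. 0) \<longlongrightarrow> a (0 + n)) (at (0::real))"
    using shifted by (intro powser_limit_0_strong[OF r]) auto
  then show "a n = 0"
    by (simp add: LIM_unique tendsto_const_iff)
qed

lemma power_div_fact_le_exp:
  fixes x :: real
  assumes "x \<ge> 0"
  shows "x ^ n / fact n \<le> exp x"
proof -
  have "(\<Sum>j\<in>{n}. x ^ j /\<^sub>R fact j) \<le> (\<Sum>j. x ^ j /\<^sub>R fact j)"
    using assms summable_exp_generic[of x] by (intro sum_le_suminf) auto
  then show ?thesis
    by (simp add: exp_def divide_inverse mult.commute)
qed

lemma exp_partial_sum_le:
  fixes x :: real
  shows "\<bar>\<Sum>j<n. x ^ j / fact j\<bar> \<le> exp \<bar>x\<bar>"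
proof -
  have "\<bar>\<Sum>j<n. x ^ j / fact j\<bar> \<le> (\<Sum>j<n. \<bar>x\<bar> ^ j /\<^sub>R fact j)"
    by (rule order_trans[OF sum_abs]) (simp add: abs_mult power_abs divide_inverse mult.commute)
  also have "\<dots> \<le> (\<Sum>j. \<bar>x\<bar> ^ j /\<^sub>R fact j)"
    using summable_exp_generic[of "\<bar>x\<bar>"] by (intro sum_le_suminf) auto
  finally show ?thesis
    by (simp add: exp_def)
qed

lemma exp_abs_le: "exp \<bar>y\<bar> \<le> exp y + exp (- y)" for y :: real
  by (cases "y \<ge> 0") auto

text \<open>
  Everything follows from the bound of the exponential series of \<open>y x\<close>, and of each of its terms, by
  \<open>exp (r x) + exp (- r x)\<close>.
\<close>
lemma (in real_distribution) moments_of_mgf: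
  assumes r: "r > 0" and exps: "integrable M (\<lambda>x. exp (r * x))" "integrable M (\<lambda>x. exp (- r * x))"
  shows "integrable M (\<lambda>x. x ^ n)"
    and "\<bar>y\<bar> \<le> r \<Longrightarrow> (\<lambda>n. (expectation (\<lambda>x. x ^ n) / fact n) * y ^ n) sums expectation (\<lambda>x. exp (y * x))"
    and "(r ^ n / fact n) * expectation (\<lambda>x. \<bar>x\<bar> ^ n) \<le> expectation (\<lambda>x. exp (r * x) + exp (- r * x))"
proof -
  let ?w = "\<lambda>x. exp (r * x) + exp (- r * x)"
  have w: "integrable M ?w"
    using exps by simp
  have dom: "exp \<bar>y * x\<bar> \<le> ?w x" if "\<bar>y\<bar> \<le> r" for x y
  proof -
    have "\<bar>y * x\<bar> \<le> \<bar>r * x\<bar>"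
      using that r by (simp add: abs_mult mult_right_mono)
    then have "exp \<bar>y * x\<bar> \<le> exp \<bar>r * x\<bar>"
      by simp
    also have "\<dots> \<le> ?w x"
      using exp_abs_le[of "r * x"] by simp
    finally show ?thesis .
  qed
  have bound: "r ^ n / fact n * \<bar>x\<bar> ^ n \<le> ?w x" for x n
  proof -
    have "r ^ n / fact n * \<bar>x\<bar> ^ n = \<bar>r * x\<bar> ^ n / fact n"
      using r by (simp add: abs_mult power_mult_distrib)
    also have "\<dots> \<le> exp \<bar>r * x\<bar>"
      by (rule power_div_fact_le_exp) simp
    also have "\<dots> \<le> ?w x"
      using dom[of r x] r by simp
    finally show ?thesis .
  qed
  show int: "integrable M (\<lambda>x. x ^ n)" for n
  proof (rule Bochner_Integration.integrable_bound)
    show "integrable M (\<lambda>x. fact n / r ^ n * ?w x)"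
      using w by (rule integrable_mult_right)
    show "AE x in M. norm (x ^ n) \<le> norm (fact n / r ^ n * ?w x)"
    proof (rule AE_I2)
      fix x
      have "\<bar>x\<bar> ^ n = fact n / r ^ n * (r ^ n / fact n * \<bar>x\<bar> ^ n)"
        using r by simp
      also have "\<dots> \<le> fact n / r ^ n * ?w x"
        using r by (intro mult_left_mono bound) auto
      also have "\<dots> \<le> norm (fact n / r ^ n * ?w x)"
        by (simp only: real_norm_def abs_ge_self)
      finally show "norm (x ^ n) \<le> norm (fact n / r ^ n * ?w x)"
        by (simp add: power_abs)
    qed
  qed simp
  have "integrable M (\<lambda>x. \<bar>x\<bar> ^ n)"
    using integrable_abs[OF int[of n]] by (simp add: power_abs)
  then have "expectation (\<lambda>x. r ^ n / fact n * \<bar>x\<bar> ^ n) \<le> expectation ?w"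
    using w bound by (intro integral_mono) auto
  then show "(r ^ n / fact n) * expectation (\<lambda>x. \<bar>x\<bar> ^ n) \<le> expectation ?w"
    by simp
  show "(\<lambda>n. (expectation (\<lambda>x. x ^ n) / fact n) * y ^ n) sums expectation (\<lambda>x. exp (y * x))" if y: "\<bar>y\<bar> \<le> r"
  proof -
    have "(\<lambda>k. expectation (\<lambda>x. \<Sum>n<k. (y * x) ^ n / fact n)) \<longlonglongrightarrow> expectation (\<lambda>x. exp (y * x))"
    proof (rule integral_dominated_convergence[where w = ?w])
      show "AE x in M. (\<lambda>k. \<Sum>n<k. (y * x) ^ n / fact n) \<longlonglongrightarrow> exp (y * x)"
        using exp_converges[of "y * x" for x] by (simp add: sums_def divide_inverse mult.commute)
      show "AE x in M. norm (\<Sum>n<k. (y * x) ^ n / fact n) \<le> ?w x" for k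
        using order_trans[OF exp_partial_sum_le dom[OF y]] by simp
    qed (use w in auto)
    also have "(\<lambda>k. expectation (\<lambda>x. \<Sum>n<k. (y * x) ^ n / fact n))
        = (\<lambda>k. \<Sum>n<k. (expectation (\<lambda>x. x ^ n) / fact n) * y ^ n)"
    proof
      fix k
      have "expectation (\<lambda>x. \<Sum>n<k. (y * x) ^ n / fact n) = expectation (\<lambda>x. \<Sum>n<k. x ^ n * (y ^ n / fact n))"
        by (simp add: power_mult_distrib mult_ac)
      also have "\<dots> = (\<Sum>n<k. expectation (\<lambda>x. x ^ n * (y ^ n / fact n)))"
        by (intro Bochner_Integration.integral_sum integrable_mult_left int)
      finally show "expectation (\<lambda>x. \<Sum>n<k. (y * x) ^ n / fact n)
          = (\<Sum>n<k. (expectation (\<lambda>x. x ^ n) / fact n) * y ^ n)"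
        by simp
    qed
    finally show ?thesis
      by (simp add: sums_def)
  qed
qed

lemma mgf_eq_imp_moments_eq:
  assumes M: "real_distribution M" and N: "real_distribution N" and r: "r > 0"
    and intM: "\<And>y. \<bar>y\<bar> \<le> r \<Longrightarrow> integrable M (\<lambda>x. exp (y * x))"
    and intN: "\<And>y. \<bar>y\<bar> \<le> r \<Longrightarrow> integrable N (\<lambda>x. exp (y * x))"
    and eq: "\<And>y. \<bar>y\<bar> \<le> r \<Longrightarrow> (\<integral>x. exp (y * x) \<partial>M) = (\<integral>x. exp (y * x) \<partial>N)"
  shows "(\<integral>x. x ^ n \<partial>M) = (\<integral>x. x ^ n \<partial>N)"
proof -
  let ?a = "\<lambda>n. (\<integral>x. x ^ n \<partial>M) / fact n" and ?b = "\<lambda>n. (\<integral>x. x ^ n \<partial>N) / fact n"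
  have "?a n - ?b n = 0"
  proof (rule powser_eq_0_imp_coeff_eq_0[OF r, of "\<lambda>n. ?a n - ?b n"])
    fix y :: real assume "\<bar>y\<bar> < r"
    then have y: "\<bar>y\<bar> \<le> r" by simp
    have "(\<lambda>n. ?a n * y ^ n - ?b n * y ^ n) sums ((\<integral>x. exp (y * x) \<partial>M) - (\<integral>x. exp (y * x) \<partial>N))"
      using real_distribution.moments_of_mgf(2)[OF M r _ _ y] real_distribution.moments_of_mgf(2)[OF N r _ _ y]
        intM[of r] intM[of "- r"] intN[of r] intN[of "- r"] r
      by (intro sums_diff) auto
    then show "(\<lambda>n. (?a n - ?b n) * y ^ n) sums 0"
      using eq[OF y] by (simp add: left_diff_distrib)
  qed
  then show ?thesis
    by simp
qed

text \<open>
  The error of the Taylor polynomial of degree \<open>n\<close> of a characteristic function is bounded by the absolute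
  moment of order \<open>n\<close>. Exponential moments make this error small for \<open>N\<close>; choosing \<open>n\<close> even turns the absolute
  moment into an ordinary one, so the error is eventually as small for \<open>M k\<close>.
\<close>
lemma moments_converge_imp_char_converges:
  assumes M: "\<And>k. real_distribution (M k)" and N: "real_distribution N"
    and int: "\<And>k n. integrable (M k) (\<lambda>x. x ^ n)"
    and conv: "\<And>n. (\<lambda>k. \<integral>x. x ^ n \<partial>M k) \<longlonglongrightarrow> (\<integral>x. x ^ n \<partial>N)"
    and exps: "\<And>c. integrable N (\<lambda>x. exp (c * x))"
  shows "(\<lambda>k. char (M k) t) \<longlonglongrightarrow> char N t"
proof (rule LIMSEQ_I)
  fix e :: real assume e: "e > 0"
  \<comment> \<open>Twice \<open>|t|\<close>, so that the Taylor errors decay like \<open>2\<^sup>-\<^sup>n\<close>; the summand \<open>1\<close> keeps \<open>r\<close> positive.\<close>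
  define r where "r = 2 * \<bar>t\<bar> + 1"
  have r: "r > 0" by (simp add: r_def)
  let ?W = "\<integral>x. exp (r * x) + exp (- r * x) \<partial>N"
  have intN: "integrable N (\<lambda>x. x ^ n)" for n
    using real_distribution.moments_of_mgf(1)[OF N r exps exps] .
  let ?eN = "\<lambda>n. 2 * \<bar>t\<bar> ^ n / fact n * (\<integral>x. \<bar>x\<bar> ^ n \<partial>N)"
  have eN: "?eN n \<le> 2 * ?W * (1 / 2) ^ n" for n
  proof -
    have "\<bar>t\<bar> ^ n \<le> (r / 2) ^ n"
      by (intro power_mono) (auto simp: r_def)
    then have "?eN n \<le> 2 * (r / 2) ^ n / fact n * (\<integral>x. \<bar>x\<bar> ^ n \<partial>N)"
      by (intro mult_right_mono divide_right_mono mult_left_mono integral_nonneg_AE) auto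
    also have "\<dots> = 2 * (1 / 2) ^ n * ((r ^ n / fact n) * (\<integral>x. \<bar>x\<bar> ^ n \<partial>N))"
      by (simp add: power_divide)
    also have "\<dots> \<le> 2 * (1 / 2) ^ n * ?W"
      by (intro mult_left_mono real_distribution.moments_of_mgf(3)[OF N r exps exps]) auto
    finally show ?thesis by (simp only: mult_ac)
  qed
  have "(\<lambda>n. 2 * ?W * (1 / 2) ^ n) \<longlonglongrightarrow> 2 * ?W * 0"
    by (intro tendsto_intros LIMSEQ_power_zero) auto
  then have "\<forall>\<^sub>F n in sequentially. 2 * ?W * (1 / 2) ^ n < e / 2"
    using e by (intro order_tendstoD(2)) auto
  then obtain n0 where "\<And>n. n \<ge> n0 \<Longrightarrow> 2 * ?W * (1 / 2) ^ n < e / 2"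
    by (auto simp: eventually_sequentially)
  then have small: "?eN (2 * n0) < e / 2"
    using eN[of "2 * n0"] by (rule order.strict_trans1[rotated]) simp
  define n where "n = 2 * n0"
  have ev: "even n" by (simp add: n_def)
  let ?c = "\<lambda>j. (\<i> * t) ^ j / fact j"
  define B where "B k = 2 * \<bar>t\<bar> ^ n / fact n * (\<integral>x. x ^ n \<partial>M k) + ?eN n
      + cmod ((\<Sum>j\<le>n. ?c j * (\<integral>x. x ^ j \<partial>M k)) - (\<Sum>j\<le>n. ?c j * (\<integral>x. x ^ j \<partial>N)))" for k
  have "B \<longlonglongrightarrow> 2 * \<bar>t\<bar> ^ n / fact n * (\<integral>x. x ^ n \<partial>N) + ?eN n
      + cmod ((\<Sum>j\<le>n. ?c j * (\<integral>x. x ^ j \<partial>N)) - (\<Sum>j\<le>n. ?c j * (\<integral>x. x ^ j \<partial>N)))"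
    unfolding B_def by (intro tendsto_intros conv)
  moreover have "2 * \<bar>t\<bar> ^ n / fact n * (\<integral>x. x ^ n \<partial>N) + ?eN n < e"
    using small ev by (simp add: n_def[symmetric] power_even_abs)
  ultimately have "\<forall>\<^sub>F k in sequentially. B k < e"
    by (intro order_tendstoD(2)) auto
  then obtain k0 where k0: "\<And>k. k \<ge> k0 \<Longrightarrow> B k < e"
    by (auto simp: eventually_sequentially)
  have "norm (char (M k) t - char N t) \<le> B k" for k
  proof -
    let ?S = "\<Sum>j\<le>n. ?c j * (\<integral>x. x ^ j \<partial>M k)" and ?S' = "\<Sum>j\<le>n. ?c j * (\<integral>x. x ^ j \<partial>N)"
    have 1: "cmod (char (M k) t - ?S) \<le> 2 * \<bar>t\<bar> ^ n / fact n * (\<integral>x. x ^ n \<partial>M k)"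
      using real_distribution.char_approx1[OF M, of n k t] int ev by (simp add: power_even_abs)
    have 2: "cmod (char N t - ?S') \<le> ?eN n"
      using real_distribution.char_approx1[OF N, of n t] intN by simp
    have tri: "norm (x - y) \<le> norm (x - a) + norm (a - b) + norm (y - b)" for x y a b :: complex
      using norm_triangle_ineq4[of "(x - a) + (a - b)" "y - b"] norm_triangle_ineq[of "x - a" "a - b"] by simp
    have arith: "a \<le> e1 \<Longrightarrow> b \<le> e2 \<Longrightarrow> a + m + b \<le> e1 + e2 + m" for a b m e1 e2 :: real
      by simp
    show ?thesis
      unfolding B_def by (rule order_trans[OF tri arith[OF 1 2]])
  qed
  then show "\<exists>k0. \<forall>k\<ge>k0. norm (char (M k) t - char N t) < e"
    using k0 by (intro exI[of _ k0]) (auto intro: order.strict_trans1)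
qed


lemma std_normal_mgf:
  "has_bochner_integral std_normal_distribution (\<lambda>x. exp (c * x)) (exp (c\<^sup>2 / 2))"
proof -
  have eq: "std_normal_density x * exp (c * x) = exp (c\<^sup>2 / 2) * normal_density c 1 x" for x
    by (simp add: normal_density_def flip: exp_add) (simp add: power2_eq_square field_simps)
  have "has_bochner_integral lborel (\<lambda>x. exp (c\<^sup>2 / 2) * normal_density c 1 x) (exp (c\<^sup>2 / 2) * 1)"
    by (intro has_bochner_integral_mult_right) (simp add: has_bochner_integral_iff)
  then show ?thesis
    by (intro has_bochner_integral_density) (auto simp: eq)
qed

lemma density_exp_inverse:
  fixes c :: real
  assumes "sets M = sets borel"
  shows "density (density M (\<lambda>x. exp (x - c))) (\<lambda>x. exp (c - x)) = M"
proof -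
  have [measurable]: "(\<lambda>x. exp (x - c)) \<in> borel_measurable M" "(\<lambda>x. exp (c - x)) \<in> borel_measurable M"
    unfolding measurable_cong_sets[OF assms refl] by simp_all
  have "density (density M (\<lambda>x. exp (x - c))) (\<lambda>x. exp (c - x)) = density M (\<lambda>x. ennreal (exp (x - c)) * ennreal (exp (c - x)))"
    by (rule density_density_eq) simp_all
  also have "(\<lambda>x. ennreal (exp (x - c)) * ennreal (exp (c - x))) = (\<lambda>x. 1)"
    by (simp flip: ennreal_mult exp_add)
  finally show ?thesis
    by (simp add: density_1)
qed

text \<open>
  Weighting a law by \<open>exp (x - 1 / 2)\<close> shifts the argument of its moment generating function by \<open>1\<close>, so knowing the
  function on the positive axis becomes knowing it near \<open>0\<close>. There it determines the moments, and these
  determine the weighted law because the weighted normal law has all exponential moments. The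
  weight can then be divided out.
\<close>
lemma normal_unique_if_positive_mgf:
  assumes nu: "real_distribution \<nu>"
    and mgf: "\<And>t. t > 0 \<Longrightarrow> has_bochner_integral \<nu> (\<lambda>x. exp (t * x)) (exp (t\<^sup>2 / 2))"
  shows "\<nu> = std_normal_distribution"
proof -
  let ?N = "std_normal_distribution"
  define tilt where "tilt M = density M (\<lambda>x. exp (x - 1 / 2))" for M :: "real measure"
  have *: "real_distribution (tilt M)"
      "\<And>y. \<bar>y\<bar> \<le> 1 / 2 \<Longrightarrow> has_bochner_integral (tilt M) (\<lambda>x. exp (y * x)) (exp ((y + 1)\<^sup>2 / 2 - 1 / 2))"
    if M: "real_distribution M" and mgf: "\<And>t. t > 0 \<Longrightarrow> has_bochner_integral M (\<lambda>x. exp (t * x)) (exp (t\<^sup>2 / 2))"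
    for M
  proof -
    interpret M: real_distribution M by fact
    have tilted: "has_bochner_integral (tilt M) (\<lambda>x. exp (y * x)) (exp ((y + 1)\<^sup>2 / 2 - 1 / 2))" if y: "\<bar>y\<bar> \<le> 1 / 2" for y
    proof -
      have eq: "exp (x - 1 / 2) *\<^sub>R exp (y * x) = exp ((y + 1) * x) * exp (- 1 / 2)" for x
        by (simp add: algebra_simps flip: exp_add)
      have "has_bochner_integral M (\<lambda>x. exp ((y + 1) * x) * exp (- 1 / 2)) (exp ((y + 1)\<^sup>2 / 2) * exp (- 1 / 2))"
        using y by (intro has_bochner_integral_mult_left mgf) auto
      then have "has_bochner_integral M (\<lambda>x. exp (x - 1 / 2) *\<^sub>R exp (y * x)) (exp ((y + 1)\<^sup>2 / 2 - 1 / 2))"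
        unfolding eq by (simp flip: exp_add)
      then show ?thesis
        unfolding tilt_def by (intro has_bochner_integral_density) auto
    qed
    then show "\<And>y. \<bar>y\<bar> \<le> 1 / 2 \<Longrightarrow> has_bochner_integral (tilt M) (\<lambda>x. exp (y * x)) (exp ((y + 1)\<^sup>2 / 2 - 1 / 2))" .
    have one: "has_bochner_integral (tilt M) (\<lambda>x. 1) (1::real)"
      using tilted[of 0] by simp
    have "emeasure (tilt M) (space (tilt M)) = (\<integral>\<^sup>+x. ennreal 1 \<partial>tilt M)"
      by simp
    also have "\<dots> = ennreal 1"
      using one by (subst nn_integral_eq_integral) (auto simp: has_bochner_integral_iff)
    finally have "prob_space (tilt M)"
      by (intro prob_spaceI) simp
    then show "real_distribution (tilt M)"
      unfolding real_distribution_def real_distribution_axioms_def by (simp add: tilt_def)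
  qed
  note N = real_dist_normal_dist
  note tnu = *[OF nu mgf] and tN = *[OF N std_normal_mgf]
  have allexp: "integrable (tilt ?N) (\<lambda>x. exp (c * x))" for c
  proof -
    have "exp (x - 1 / 2) * exp (c * x) = exp ((c + 1) * x) * exp (- 1 / 2)" for x
      by (simp add: algebra_simps flip: exp_add)
    moreover have "integrable ?N (\<lambda>x. exp ((c + 1) * x) * exp (- 1 / 2))"
      using std_normal_mgf[of "c + 1"] by (intro integrable_mult_left) (simp add: has_bochner_integral_iff)
    ultimately show ?thesis
      unfolding tilt_def by (subst integrable_density) auto
  qed
  have mom: "(\<integral>x. x ^ n \<partial>tilt \<nu>) = (\<integral>x. x ^ n \<partial>tilt ?N)" for n
    by (rule mgf_eq_imp_moments_eq[OF tnu(1) tN(1), of "1 / 2"])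
       (use tnu(2) tN(2) in \<open>auto simp: has_bochner_integral_iff\<close>)
  have int: "integrable (tilt \<nu>) (\<lambda>x. x ^ n)" for n
    using tnu(2)[of "1 / 2"] tnu(2)[of "- 1 / 2"]
    by (intro real_distribution.moments_of_mgf(1)[OF tnu(1), of "1 / 2"]) (auto simp: has_bochner_integral_iff)
  have "(\<lambda>k::nat. char (tilt \<nu>) t) \<longlonglongrightarrow> char (tilt ?N) t" for t
    by (rule moments_converge_imp_char_converges[OF tnu(1) tN(1)]) (simp_all add: int mom allexp)
  then have "char (tilt \<nu>) = char (tilt ?N)"
    by (auto simp: tendsto_const_iff)
  then have "tilt \<nu> = tilt ?N"
    using Levy_uniqueness[OF tnu(1) tN(1)] by blast
  then have "density (tilt \<nu>) (\<lambda>x. exp (1 / 2 - x)) = density (tilt ?N) (\<lambda>x. exp (1 / 2 - x))"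
    by simp
  then show ?thesis
    unfolding tilt_def using nu N
    by (simp add: density_exp_inverse real_distribution.events_eq_borel)
qed

section \<open>Moments of the Poisson distribution\<close>

lemma poisson_has_bochner_integral:
  fixes f :: "nat \<Rightarrow> real"
  assumes l: "l > 0" and nonneg: "\<And>x. f x \<ge> 0" and s: "(\<lambda>x. l ^ x / fact x * exp (- l) * f x) sums s"
  shows "has_bochner_integral (measure_pmf (poisson_pmf l)) f s"
proof -
  have int: "integrable (count_space UNIV) (\<lambda>x. l ^ x / fact x * exp (- l) * f x)"
    unfolding integrable_count_space_nat_iff using sums_summable[OF s] l nonneg by simp
  then have "has_bochner_integral (count_space UNIV) (\<lambda>x. l ^ x / fact x * exp (- l) * f x) s"
    using sums_unique2[OF sums_integral_count_space_nat[OF int] s] by (simp add: has_bochner_integral_iff)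
  then show ?thesis
    unfolding measure_pmf_eq_density using l
    by (intro has_bochner_integral_density) (auto simp: mult_ac)
qed

lemma poisson_mgf:
  assumes "l > 0"
  shows "has_bochner_integral (measure_pmf (poisson_pmf l)) (\<lambda>x. exp (c * real x)) (exp (l * exp c) * exp (- l))"
proof (rule poisson_has_bochner_integral[OF assms])
  have "(\<lambda>x. (l * exp c) ^ x /\<^sub>R fact x * exp (- l)) sums (exp (l * exp c) * exp (- l))"
    by (intro sums_mult2 exp_converges)
  then show "(\<lambda>x. l ^ x / fact x * exp (- l) * exp (c * real x)) sums (exp (l * exp c) * exp (- l))"
    unfolding exp_of_nat2_mult by (simp add: power_mult_distrib divide_inverse mult_ac)
qed simp

lemma poisson_factorial_moment:
  assumes "l > 0"
  shows "has_bochner_integral (measure_pmf (poisson_pmf l)) (\<lambda>x. fact q * real (x choose q)) (l ^ q)"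
proof (rule poisson_has_bochner_integral[OF assms])
  let ?g = "\<lambda>x. l ^ x / fact x * exp (- l) * (fact q * real (x choose q))"
  have "(\<lambda>j. l ^ j /\<^sub>R fact j * (l ^ q * exp (- l))) sums (exp l * (l ^ q * exp (- l)))"
    by (intro sums_mult2 exp_converges)
  moreover have "?g (j + q) = l ^ j /\<^sub>R fact j * (l ^ q * exp (- l))" for j
  proof -
    have "real (j + q choose q) = fact (j + q) / (fact q * fact j)"
      by (subst binomial_fact) auto
    moreover have "a / F * e * (Q * (F / (Q * J))) = a * e / J" if "F \<noteq> 0" "Q \<noteq> 0" for a F e Q J :: real
      using that by simp
    ultimately have "?g (j + q) = l ^ (j + q) * exp (- l) / fact j"
      by simp
    then show ?thesis
      by (simp only: power_add scaleR_conv_of_real) (simp add: divide_inverse mult_ac)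
  qed
  ultimately have "(\<lambda>j. ?g (j + q)) sums (exp l * (l ^ q * exp (- l)))"
    by simp
  then have "?g sums (exp l * (l ^ q * exp (- l)) + (\<Sum>i<q. ?g i))"
    by (rule sums_iff_shift[THEN iffD1])
  moreover have "(\<Sum>i<q. ?g i) = 0"
    by (intro sum.neutral) (simp add: binomial_eq_0)
  moreover have "exp l * (l ^ q * exp (- l)) = l ^ q"
    by (simp add: exp_minus)
  ultimately show "?g sums l ^ q"
    by simp
qed simp

text \<open>
  The coefficients are Stirling numbers of the second kind. As they do not depend on \<open>x\<close>, convergence of all
  factorial moments carries over to all moments.
\<close>
lemma power_eq_sum_factorial_binomials:
  "\<exists>c. \<forall>x. real x ^ r = (\<Sum>j\<le>r. c j * (fact j * real (x choose j)))"
proof (induction r)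
  case 0
  show ?case by (rule exI[of _ "\<lambda>_. 1"]) simp
next
  case (Suc r)
  then obtain c where c: "\<And>x. real x ^ r = (\<Sum>j\<le>r. c j * (fact j * real (x choose j)))"
    by blast
  have step: "real x * (fact j * real (x choose j))
      = fact (Suc j) * real (x choose Suc j) + real j * (fact j * real (x choose j))" for x j
    using gbinomial_mult_1[of "real x" j] by (simp add: binomial_gbinomial algebra_simps)
  define d where "d j = (if j = 0 then 0 else c (j - 1)) + (if j \<le> r then real j * c j else 0)" for j
  have "real x ^ Suc r = (\<Sum>j\<le>Suc r. d j * (fact j * real (x choose j)))" for x
  proof -
    let ?b = "\<lambda>j. fact j * real (x choose j)"
    have "real x ^ Suc r = (\<Sum>j\<le>r. c j * (real x * ?b j))"
      by (simp add: c sum_distrib_left mult_ac)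
    also have "\<dots> = (\<Sum>j\<le>r. c j * ?b (Suc j)) + (\<Sum>j\<le>r. real j * c j * ?b j)"
      unfolding step by (simp add: sum.distrib algebra_simps)
    also have "(\<Sum>j\<le>r. c j * ?b (Suc j)) = (\<Sum>j\<le>Suc r. (if j = 0 then 0 else c (j - 1)) * ?b j)"
      by (subst sum.atMost_Suc_shift) simp
    also have "(\<Sum>j\<le>r. real j * c j * ?b j) = (\<Sum>j\<le>Suc r. (if j \<le> r then real j * c j else 0) * ?b j)"
      by simp
    finally show ?thesis
      by (simp add: d_def distrib_right sum.distrib)
  qed
  then show ?case by blast
qed

section \<open>The normal limit from large factorial moments\<close>

lemma scaled_ffact_add:
  "scaled_ffact s (q + r) x = scaled_ffact s q x * (\<Prod>j<r. (real x - real (q + j)) / s)"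
  unfolding scaled_ffact_eq_prod by (induction r) simp_all

lemma floor_mult_bounds:
  assumes "t > 0" "u > 0"
  shows "real (nat \<lfloor>t * u\<rfloor>) \<le> t * u" "t * u - 1 < real (nat \<lfloor>t * u\<rfloor>)"
proof -
  have "real (nat \<lfloor>t * u\<rfloor>) = real_of_int \<lfloor>t * u\<rfloor>"
    using assms by simp
  then show "real (nat \<lfloor>t * u\<rfloor>) \<le> t * u" "t * u - 1 < real (nat \<lfloor>t * u\<rfloor>)"
    by linarith+
qed

text \<open>
  With \<open>u = \<surd>s\<close> and \<open>x = s + z u\<close> the factors are \<open>1 + a j\<close> with \<open>a j = z / u - j / u\<^sup>2\<close>, of order \<open>1 / u\<close>. There are
  \<open>q \<approx> t u\<close> of them, so replacing \<open>ln (1 + a j)\<close> by \<open>a j\<close> costs \<open>O(1 / u)\<close> in total, and the sum of the \<open>a j\<close> is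
  \<open>t z - t\<^sup>2 / 2 + O(1 / u)\<close>.
\<close>
lemma scaled_ffact_bulk:
  fixes A t u z :: real
  assumes t: "t > 0" and A: "A \<ge> 0" and u: "u > 0" "2 * (A + t) \<le> u"
    and x: "real x = u\<^sup>2 + z * u" and z: "\<bar>z\<bar> \<le> A" and q: "q = nat \<lfloor>t * u\<rfloor>"
  defines "K \<equiv> 2 * t * (A + t)\<^sup>2 + A + 3 * t"
  shows "exp (t * z - t\<^sup>2 / 2) \<le> exp (K / u) * scaled_ffact (u\<^sup>2) q x"
    and "exp (- (K / u)) * scaled_ffact (u\<^sup>2) q x \<le> exp (t * z - t\<^sup>2 / 2)"
proof -
  note qb = floor_mult_bounds[OF t u(1), folded q]
  define a where "a j = z / u - real j / u\<^sup>2" for j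
  have factor: "(real x - real j) / u\<^sup>2 = 1 + a j" for j
    using u by (simp add: x a_def field_simps power2_eq_square)
  have a: "\<bar>a j\<bar> \<le> (A + t) / u" if "j < q" for j
  proof -
    have "\<bar>a j\<bar> \<le> \<bar>z / u\<bar> + \<bar>real j / u\<^sup>2\<bar>"
      unfolding a_def by (rule abs_triangle_ineq4)
    also have "\<bar>z / u\<bar> \<le> A / u"
      using z u by (simp add: divide_right_mono)
    also have "\<bar>real j / u\<^sup>2\<bar> \<le> t * u / u\<^sup>2"
      using that qb by (auto intro!: divide_right_mono)
    also have "t * u / u\<^sup>2 = t / u"
      using u by (simp add: power2_eq_square)
    finally show ?thesis
      by (simp add: add_divide_distrib)
  qed
  have half: "(A + t) / u \<le> 1 / 2"
    using u by (simp add: field_simps)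
  have pos: "1 + a j > 0" if "j < q" for j
    using a[OF that] half by linarith
  have g: "scaled_ffact (u\<^sup>2) q x = (\<Prod>j<q. 1 + a j)"
    by (simp add: scaled_ffact_eq_prod factor)
  then have g_pos: "scaled_ffact (u\<^sup>2) q x > 0"
    using pos unfolding g by (intro prod_pos) auto
  have ln_g: "ln (scaled_ffact (u\<^sup>2) q x) = (\<Sum>j<q. ln (1 + a j))"
    unfolding g using pos by (intro ln_prod) (use less_irrefl in fastforce)+
  have "\<bar>ln (scaled_ffact (u\<^sup>2) q x) - (\<Sum>j<q. a j)\<bar> \<le> 2 * t * (A + t)\<^sup>2 / u"
  proof -
    have "\<bar>ln (scaled_ffact (u\<^sup>2) q x) - (\<Sum>j<q. a j)\<bar> \<le> (\<Sum>j<q. \<bar>ln (1 + a j) - a j\<bar>)"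
      unfolding ln_g sum_subtractf[symmetric] by (rule sum_abs)
    also have "\<dots> \<le> (\<Sum>j<q. 2 * ((A + t) / u)\<^sup>2)"
    proof (rule sum_mono)
      fix j assume j: "j \<in> {..<q}"
      then have "\<bar>ln (1 + a j) - a j\<bar> \<le> 2 * (a j)\<^sup>2"
        using order_trans[OF a half] by (intro abs_ln_one_plus_x_minus_x_bound) auto
      also have "(a j)\<^sup>2 \<le> ((A + t) / u)\<^sup>2"
        using power_mono[OF a[of j] abs_ge_zero, of 2] j by simp
      finally show "\<bar>ln (1 + a j) - a j\<bar> \<le> 2 * ((A + t) / u)\<^sup>2" by simp
    qed
    also have "\<dots> = real q * (2 * ((A + t) / u)\<^sup>2)"
      by simp
    also have "\<dots> \<le> (t * u) * (2 * ((A + t) / u)\<^sup>2)"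
      using qb by (intro mult_right_mono) auto
    also have "\<dots> = 2 * t * (A + t)\<^sup>2 / u"
      using u by (simp add: power2_eq_square field_simps)
    finally show ?thesis .
  qed
  moreover have "\<bar>(\<Sum>j<q. a j) - (t * z - t\<^sup>2 / 2)\<bar> \<le> (A + 3 * t) / u"
  proof -
    have gauss: "(\<Sum>j<q. real j) = real q * (real q - 1) / 2"
      by (induction q) (auto simp: field_simps)
    have "(\<Sum>j<q. a j) = real q * z / u - real q * (real q - 1) / 2 / u\<^sup>2"
      unfolding a_def sum_subtractf sum_divide_distrib[symmetric] gauss by simp
    also have "\<dots> - (t * z - t\<^sup>2 / 2) = (real q - t * u) * z / u - (real q * (real q - 1) - (t * u)\<^sup>2) / 2 / u\<^sup>2"
      using u by (simp add: field_simps power2_eq_square)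
    finally have eq: "(\<Sum>j<q. a j) - (t * z - t\<^sup>2 / 2)
        = (real q - t * u) * z / u - (real q * (real q - 1) - (t * u)\<^sup>2) / 2 / u\<^sup>2" .
    have "\<bar>(real q - t * u) * z / u\<bar> \<le> 1 * A / u"
      unfolding abs_mult abs_divide using u qb z
      by (intro frac_le mult_mono) auto
    moreover have "\<bar>real q * (real q - 1) - (t * u)\<^sup>2\<bar> \<le> 3 * (t * u)"
    proof -
      define f where "f = t * u - real q"
      have f: "0 \<le> f" "f < 1"
        using qb by (auto simp: f_def)
      have qf: "real q = t * u - f"
        by (simp add: f_def)
      have "real q * (real q - 1) \<le> real q * real q"
        by (intro mult_left_mono) auto
      also have "\<dots> \<le> (t * u) * (t * u)"
        using qb t u by (intro mult_mono) auto
      finally have up: "real q * (real q - 1) \<le> (t * u)\<^sup>2"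
        by (simp add: power2_eq_square)
      have "real q * (real q - 1) = (t * u)\<^sup>2 - t * u * (2 * f + 1) + f * (f + 1)"
        unfolding qf by (simp add: power2_eq_square algebra_simps)
      moreover have "t * u * (2 * f + 1) \<le> t * u * 3"
        using f t u by (intro mult_left_mono) auto
      moreover have "f * (f + 1) \<ge> 0"
        using f by simp
      ultimately have "(t * u)\<^sup>2 - real q * (real q - 1) \<le> 3 * (t * u)"
        by linarith
      then show ?thesis
        using up t u by (simp add: abs_if)
    qed
    then have "\<bar>(real q * (real q - 1) - (t * u)\<^sup>2) / 2 / u\<^sup>2\<bar> \<le> 3 * (t * u) / 2 / u\<^sup>2"
      by (simp add: divide_right_mono)
    moreover have "3 * (t * u) / 2 / u\<^sup>2 \<le> 3 * t / u"
      using u t by (simp add: power2_eq_square field_simps)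
    ultimately show ?thesis
      unfolding eq add_divide_distrib by linarith
  qed
  ultimately have "\<bar>ln (scaled_ffact (u\<^sup>2) q x) - (t * z - t\<^sup>2 / 2)\<bar> \<le> K / u"
    unfolding K_def add_divide_distrib by linarith
  then have le: "t * z - t\<^sup>2 / 2 \<le> K / u + ln (scaled_ffact (u\<^sup>2) q x)"
    "- (K / u) + ln (scaled_ffact (u\<^sup>2) q x) \<le> t * z - t\<^sup>2 / 2"
    by linarith+
  show "exp (t * z - t\<^sup>2 / 2) \<le> exp (K / u) * scaled_ffact (u\<^sup>2) q x"
    using iffD2[OF exp_le_cancel_iff le(1)] g_pos by (simp add: exp_add)
  show "exp (- (K / u)) * scaled_ffact (u\<^sup>2) q x \<le> exp (t * z - t\<^sup>2 / 2)"
    using iffD2[OF exp_le_cancel_iff le(2)] g_pos by (simp only: exp_add exp_ln)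
qed

text \<open>
  Above \<open>s + A \<surd>s\<close> the next \<open>q\<close> factors are all at least \<open>1 + (A - 2 t) / \<surd>s\<close>, so their product is large by
  Bernoulli's inequality. The factorial moment of order \<open>2 q\<close>, also about \<open>1\<close> after scaling, thus
  bounds the mass in the upper tail.
\<close>
lemma scaled_ffact_upper_tail:
  fixes A t u :: real
  assumes t: "t > 0" and A: "A > 2 * t" and u: "u > 0" "2 \<le> t * u"
    and x: "real x \<ge> u\<^sup>2 + A * u" and q: "q = nat \<lfloor>t * u\<rfloor>"
  shows "scaled_ffact (u\<^sup>2) q x \<le> 2 / (t * (A - 2 * t)) * scaled_ffact (u\<^sup>2) (2 * q) x"
proof -
  note qb = floor_mult_bounds[OF t u(1), folded q]
  define b where "b = A - 2 * t"
  have b: "b > 0"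
    using A by (simp add: b_def)
  have "t * b / 2 \<le> 1 + real q * (b / u)"
  proof -
    have "t * u / 2 \<le> real q"
      using qb u by linarith
    then have "t * u / 2 * (b / u) \<le> real q * (b / u)"
      using b u by (intro mult_right_mono) auto
    then show ?thesis
      using u by simp
  qed
  also have "\<dots> \<le> (1 + b / u) ^ q"
    using b u by (intro Bernoulli_inequality) (auto intro: order_trans[of _ 0])
  also have "\<dots> = (\<Prod>j<q. 1 + b / u)"
    by simp
  also have "\<dots> \<le> (\<Prod>j<q. (real x - real (q + j)) / u\<^sup>2)"
  proof (rule prod_mono, intro conjI)
    fix j assume "j \<in> {..<q}"
    then have "real (q + j) \<le> 2 * (t * u)"
      using qb by simp
    then have "u\<^sup>2 + b * u \<le> real x - real (q + j)"
      using x by (simp add: b_def algebra_simps)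
    then have "(u\<^sup>2 + b * u) / u\<^sup>2 \<le> (real x - real (q + j)) / u\<^sup>2"
      by (rule divide_right_mono) simp
    moreover have "(u\<^sup>2 + b * u) / u\<^sup>2 = 1 + b / u"
      using u by (simp add: field_simps power2_eq_square)
    ultimately show "1 + b / u \<le> (real x - real (q + j)) / u\<^sup>2"
      by simp
    show "0 \<le> 1 + b / u"
      using b u by simp
  qed
  finally have "scaled_ffact (u\<^sup>2) q x * (t * b / 2) \<le> scaled_ffact (u\<^sup>2) (q + q) x"
    unfolding scaled_ffact_add using u by (intro mult_left_mono scaled_ffact_nonneg) auto
  then have "scaled_ffact (u\<^sup>2) q x \<le> scaled_ffact (u\<^sup>2) (q + q) x / (t * b / 2)"
    using b t by (subst pos_le_divide_eq) auto
  then show ?thesis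
    unfolding b_def[symmetric] by (simp add: mult_2[symmetric] mult_ac)
qed

text \<open>
  Below \<open>s - A \<surd>s\<close> the plain power \<open>(x / s)\<^sup>q\<close> already suffices as an upper bound.
\<close>
lemma scaled_ffact_lower_tail:
  fixes A t u :: real
  assumes t: "t > 0" and A: "A \<ge> 0" and u: "u > 0" "2 \<le> t * u"
    and x: "real x \<le> u\<^sup>2 - A * u" and q: "q = nat \<lfloor>t * u\<rfloor>"
  shows "scaled_ffact (u\<^sup>2) q x \<le> exp (- (A * t / 2))"
proof -
  note qb = floor_mult_bounds[OF t u(1), folded q]
  have "fact q * real (x choose q) \<le> real x ^ q"
    using of_nat_mono[OF binomial_fact_pow[of x q], where 'a = real] by (simp add: mult.commute)
  then have "scaled_ffact (u\<^sup>2) q x \<le> real x ^ q / (u\<^sup>2) ^ q"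
    unfolding scaled_ffact_def by (rule divide_right_mono) simp
  also have "\<dots> = (real x / u\<^sup>2) ^ q"
    by (simp add: power_divide)
  also have "\<dots> \<le> exp (- (A / u)) ^ q"
  proof (rule power_mono)
    have "real x / u\<^sup>2 \<le> (u\<^sup>2 - A * u) / u\<^sup>2"
      using x by (rule divide_right_mono) simp
    also have "\<dots> = 1 + - (A / u)"
      using u by (simp add: field_simps power2_eq_square)
    also have "\<dots> \<le> exp (- (A / u))"
      by (rule exp_ge_add_one_self)
    finally show "real x / u\<^sup>2 \<le> exp (- (A / u))" .
  qed simp
  also have "\<dots> = exp (- (A / u * real q))"
    by (simp only: exp_of_nat2_mult[symmetric] mult_minus_left)
  also have "\<dots> \<le> exp (- (A * t / 2))"
  proof -
    have "t * u / 2 \<le> real q"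
      using qb u by linarith
    then have "A / u * (t * u / 2) \<le> A / u * real q"
      using A u by (intro mult_left_mono) auto
    then show ?thesis
      using u by simp
  qed
  finally show ?thesis .
qed


text \<open>
  A bounded continuous substitute for \<open>exp (t z - t\<^sup>2 / 2)\<close>: equal to it for \<open>|z| \<le> A\<close> and zero for \<open>|z| \<ge> A + 1\<close>, so
  that weak convergence can be applied.
\<close>
definition cutoff_exp :: "real \<Rightarrow> real \<Rightarrow> real \<Rightarrow> real" where
  "cutoff_exp t A z = max 0 (min 1 (A + 1 - \<bar>z\<bar>)) * exp (t * z - t\<^sup>2 / 2)"

lemma cutoff_exp_bounds: "0 \<le> cutoff_exp t A z" "cutoff_exp t A z \<le> exp (t * z - t\<^sup>2 / 2)"
  unfolding cutoff_exp_def by (auto intro!: mult_left_le_one_le mult_nonneg_nonneg)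

lemma cutoff_exp_eq:
  "\<bar>z\<bar> \<le> A \<Longrightarrow> cutoff_exp t A z = exp (t * z - t\<^sup>2 / 2)"
  "\<bar>z\<bar> > A + 1 \<Longrightarrow> cutoff_exp t A z = 0"
  by (auto simp: cutoff_exp_def)

lemma isCont_cutoff_exp: "isCont (cutoff_exp t A) z"
  unfolding cutoff_exp_def by (intro continuous_intros)

lemma borel_measurable_cutoff_exp [measurable]: "cutoff_exp t A \<in> borel_measurable borel"
  using isCont_cutoff_exp by (intro borel_measurable_continuous_onI continuous_at_imp_continuous_on) auto

lemma cutoff_exp_bounded:
  assumes "t > 0"
  shows "norm (cutoff_exp t A z) \<le> exp (t * (A + 1))"
proof (cases "\<bar>z\<bar> > A + 1")
  case False
  have "t * z - t\<^sup>2 / 2 \<le> t * z"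
    by simp
  also have "\<dots> \<le> t * (A + 1)"
    using False assms by (intro mult_left_mono) auto
  finally have "exp (t * z - t\<^sup>2 / 2) \<le> exp (t * (A + 1))"
    by simp
  then have "cutoff_exp t A z \<le> exp (t * (A + 1))"
    by (rule order_trans[OF cutoff_exp_bounds(2)])
  then show ?thesis
    using cutoff_exp_bounds(1)[of t A z] by simp
qed (simp add: cutoff_exp_eq)

lemma cutoff_exp_mono: "A \<le> B \<Longrightarrow> cutoff_exp t A z \<le> cutoff_exp t B z"
  unfolding cutoff_exp_def by (intro mult_right_mono) auto

text \<open>
  Take \<open>q = \<lfloor>t \<surd>s\<rfloor>\<close>. The expectation of the scaled falling factorial tends to \<open>1\<close>. On \<open>|Z| \<le> A\<close> it is close to
  \<open>exp (t Z - t\<^sup>2 / 2)\<close>, and the two tail estimates bound the rest by a quantity that vanishes as \<open>A \<rightarrow> \<infinity>\<close>.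
  Passing to the weak limit with \<open>cutoff_exp\<close> and then letting \<open>A \<rightarrow> \<infinity>\<close> by monotone convergence
  gives the claim. The restriction to \<open>t > 0\<close> comes from the method: negative \<open>t\<close> would
  require alternating sums of factorial moments, in which the error terms dominate.
\<close>
lemma positive_mgf_of_weak_limit:
  fixes P :: "nat \<Rightarrow> nat pmf" and s :: "nat \<Rightarrow> real"
  assumes fin: "\<And>k. finite (set_pmf (P k))"
    and s_pos: "\<And>k. s k > 0" and s_lim: "filterlim s at_top sequentially"
    and fm: "\<And>C e. e > 0 \<Longrightarrow> \<forall>\<^sub>F k in sequentially. \<forall>q. real q \<le> C * sqrt (s k) \<longrightarrow>
              \<bar>measure_pmf.expectation (P k) (scaled_ffact (s k) q) - 1\<bar> \<le> e"
    and nu: "real_distribution \<nu>"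
    and weak: "weak_conv_m (\<lambda>k. distr (P k) borel (\<lambda>x. (real x - s k) / sqrt (s k))) \<nu>"
    and t: "t > 0"
  shows "has_bochner_integral \<nu> (\<lambda>z. exp (t * z)) (exp (t\<^sup>2 / 2))"
proof -
  interpret \<nu>: real_distribution \<nu> by fact
  define u where "u k = sqrt (s k)" for k
  have u_pos: "u k > 0" and u2: "(u k)\<^sup>2 = s k" for k
    using s_pos[of k] by (auto simp: u_def)
  have u_lim: "filterlim u at_top sequentially"
    unfolding u_def by (rule filterlim_compose[OF sqrt_at_top s_lim])
  define q where "q k = nat \<lfloor>t * u k\<rfloor>" for k
  define Z where "Z k x = (real x - s k) / u k" for k x
  have xZ: "real x = (u k)\<^sup>2 + Z k x * u k" for k x
    using u_pos[of k] by (simp add: Z_def u2)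
  let ?E = "\<lambda>k. measure_pmf.expectation (P k)"
  have int: "integrable (measure_pmf (P k)) f" for k and f :: "nat \<Rightarrow> real"
    by (rule integrable_measure_pmf_finite) (rule fin)
  have E1: "(\<lambda>k. ?E k (scaled_ffact (s k) (m * q k))) \<longlonglongrightarrow> 1" for m :: nat
  proof (rule LIMSEQ_I)
    fix e :: real assume "e > 0"
    then have "\<forall>\<^sub>F k in sequentially. \<forall>q. real q \<le> (real m * t) * sqrt (s k) \<longrightarrow>
              \<bar>?E k (scaled_ffact (s k) q) - 1\<bar> \<le> e / 2"
      by (intro fm) simp
    then obtain k0 where k0: "\<And>k q. k \<ge> k0 \<Longrightarrow> real q \<le> (real m * t) * sqrt (s k) \<Longrightarrow>
              \<bar>?E k (scaled_ffact (s k) q) - 1\<bar> \<le> e / 2"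
      unfolding eventually_sequentially by blast
    have "norm (?E k (scaled_ffact (s k) (m * q k)) - 1) < e" if "k \<ge> k0" for k
    proof -
      have "real (m * q k) \<le> real m * t * sqrt (s k)"
        using floor_mult_bounds(1)[OF t u_pos[of k]] mult_left_mono[of "real (q k)" "t * u k" "real m"]
        by (simp add: q_def u_def mult_ac)
      then have "\<bar>?E k (scaled_ffact (s k) (m * q k)) - 1\<bar> \<le> e / 2"
        by (rule k0[OF that])
      then show ?thesis
        using \<open>e > 0\<close> by simp
    qed
    then show "\<exists>k0. \<forall>k\<ge>k0. norm (?E k (scaled_ffact (s k) (m * q k)) - 1) < e"
      by blast
  qed
  have Eh: "(\<lambda>k. ?E k (\<lambda>x. cutoff_exp t A (Z k x))) \<longlonglongrightarrow> (\<integral>z. cutoff_exp t A z \<partial>\<nu>)" for A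
  proof -
    have "(\<lambda>k. \<integral>z. cutoff_exp t A z \<partial>distr (P k) borel (\<lambda>x. (real x - s k) / sqrt (s k))) \<longlonglongrightarrow> (\<integral>z. cutoff_exp t A z \<partial>\<nu>)"
      using weak nu t isCont_cutoff_exp cutoff_exp_bounded
      by (intro weak_conv_imp_integral_bdd_continuous_conv prob_space.real_distribution_distr[OF prob_space_measure_pmf]) auto
    then show ?thesis
      by (simp add: integral_distr Z_def u_def)
  qed
  have Klim: "(\<lambda>k. exp (K / u k)) \<longlonglongrightarrow> 1" for K
    using tendsto_exp[OF tendsto_divide_0[OF tendsto_const filterlim_at_top_imp_at_infinity[OF u_lim]]] by simp
  have up: "(\<integral>z. cutoff_exp t A z \<partial>\<nu>) \<le> 1" if A: "A \<ge> 0" for A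
  proof -
    define K where "K = 2 * t * ((A + 1) + t)\<^sup>2 + (A + 1) + 3 * t"
    have "\<forall>\<^sub>F k in sequentially. 2 * ((A + 1) + t) \<le> u k"
      using u_lim by (simp add: filterlim_at_top)
    then have ev: "\<forall>\<^sub>F k in sequentially. ?E k (\<lambda>x. cutoff_exp t A (Z k x))
        \<le> exp (K / u k) * ?E k (scaled_ffact (s k) (1 * q k))"
    proof eventually_elim
      case (elim k)
      have "cutoff_exp t A (Z k x) \<le> exp (K / u k) * scaled_ffact (s k) (q k) x" for x
      proof (cases "\<bar>Z k x\<bar> \<le> A + 1")
        case True
        have "exp (t * Z k x - t\<^sup>2 / 2) \<le> exp (K / u k) * scaled_ffact (s k) (q k) x"
          using scaled_ffact_bulk(1)[OF t _ u_pos elim xZ True q_def] A by (simp add: K_def u2)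
        then show ?thesis
          using cutoff_exp_bounds(2) order_trans by blast
      next
        case False
        then show ?thesis
          using scaled_ffact_nonneg[OF s_pos] by (simp add: cutoff_exp_eq)
      qed
      then have "?E k (\<lambda>x. cutoff_exp t A (Z k x)) \<le> ?E k (\<lambda>x. exp (K / u k) * scaled_ffact (s k) (q k) x)"
        by (intro integral_mono int) auto
      then show ?case
        by simp
    qed
    have lim: "(\<lambda>k. exp (K / u k) * ?E k (scaled_ffact (s k) (1 * q k))) \<longlonglongrightarrow> 1 * 1"
      by (intro tendsto_mult Klim E1)
    show ?thesis
      using tendsto_le[OF sequentially_bot lim Eh ev] by simp
  qed
  have lo: "1 \<le> (\<integral>z. cutoff_exp t A z \<partial>\<nu>) + (2 / (t * (A - 2 * t)) + exp (- (A * t / 2)))" if A: "A > 2 * t" for A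
  proof -
    define K where "K = 2 * t * (A + t)\<^sup>2 + A + 3 * t"
    let ?c = "2 / (t * (A - 2 * t))"
    have c: "?c \<ge> 0"
      using A t by simp
    have "\<forall>\<^sub>F k in sequentially. 2 * (A + t) \<le> u k"
      using u_lim by (simp add: filterlim_at_top)
    moreover have "\<forall>\<^sub>F k in sequentially. 2 / t \<le> u k"
      using u_lim by (simp add: filterlim_at_top)
    ultimately have ev: "\<forall>\<^sub>F k in sequentially. exp (- K / u k) * ?E k (scaled_ffact (s k) (1 * q k))
        \<le> ?E k (\<lambda>x. cutoff_exp t A (Z k x))
           + (?c * ?E k (scaled_ffact (s k) (2 * q k)) + exp (- (A * t / 2)))"
    proof eventually_elim
      case (elim k)
      have tu: "2 \<le> t * u k"
        using elim(2) t by (simp add: field_simps)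
      have K: "exp (- K / u k) \<le> 1"
      proof -
        have "K \<ge> 0"
          using A t by (simp add: K_def)
        then show ?thesis
          using u_pos[of k] by (simp add: divide_nonpos_pos)
      qed
      have "exp (- K / u k) * scaled_ffact (s k) (q k) x
        \<le> cutoff_exp t A (Z k x) + (?c * scaled_ffact (s k) (2 * q k) x + exp (- (A * t / 2)))" (is "?l \<le> ?r1 + (?r2 + ?r3)") for x
      proof -
        have nn: "?r1 \<ge> 0" "?r2 \<ge> 0" "?r3 \<ge> 0"
          using cutoff_exp_bounds(1) c scaled_ffact_nonneg[OF s_pos] by auto
        have l: "?l \<le> scaled_ffact (s k) (q k) x"
          using mult_right_mono[OF K scaled_ffact_nonneg[OF s_pos[of k]]] by simp
        consider "\<bar>Z k x\<bar> \<le> A" | "Z k x > A" | "Z k x < - A"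
          by linarith
        then show ?thesis
        proof cases
          case 1
          have "?l \<le> ?r1"
            using scaled_ffact_bulk(2)[OF t _ u_pos elim(1) xZ 1 q_def] A t 1
            unfolding K_def[symmetric] u2 by (simp add: cutoff_exp_eq)
          then show ?thesis using nn by linarith
        next
          case 2
          then have "real x \<ge> (u k)\<^sup>2 + A * u k"
            using xZ[of x k] u_pos[of k] by simp
          then have "scaled_ffact (s k) (q k) x \<le> ?r2"
            using scaled_ffact_upper_tail[OF t A u_pos tu _ q_def, of x] by (simp add: u2)
          then show ?thesis using nn l by linarith
        next
          case 3
          then have "Z k x * u k \<le> - A * u k"
            using u_pos[of k] by (intro mult_right_mono) auto
          then have "real x \<le> (u k)\<^sup>2 - A * u k"
            using xZ[of x k] by simp
          then have "scaled_ffact (s k) (q k) x \<le> ?r3"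
            using scaled_ffact_lower_tail[OF t _ u_pos tu _ q_def, of A x] A t by (simp add: u2)
          then show ?thesis using nn l by linarith
        qed
      qed
      then have "?E k (\<lambda>x. exp (- K / u k) * scaled_ffact (s k) (q k) x)
          \<le> ?E k (\<lambda>x. cutoff_exp t A (Z k x) + (?c * scaled_ffact (s k) (2 * q k) x + exp (- (A * t / 2))))"
        by (intro integral_mono int) auto
      also have "\<dots> = ?E k (\<lambda>x. cutoff_exp t A (Z k x))
           + (?c * ?E k (scaled_ffact (s k) (2 * q k)) + exp (- (A * t / 2)))"
        by (simp add: int)
      finally show ?case
        by simp
    qed
    have lim1: "(\<lambda>k. exp (- K / u k) * ?E k (scaled_ffact (s k) (1 * q k))) \<longlonglongrightarrow> 1 * 1"
      by (intro tendsto_mult Klim E1)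
    have lim2: "(\<lambda>k. ?E k (\<lambda>x. cutoff_exp t A (Z k x))
           + (?c * ?E k (scaled_ffact (s k) (2 * q k)) + exp (- (A * t / 2))))
        \<longlonglongrightarrow> (\<integral>z. cutoff_exp t A z \<partial>\<nu>) + (?c * 1 + exp (- (A * t / 2)))"
      by (intro tendsto_intros Eh E1)
    show ?thesis
      using tendsto_le[OF sequentially_bot lim2 lim1 ev] by simp
  qed
  have lim: "(\<lambda>i. \<integral>z. cutoff_exp t (real i) z \<partial>\<nu>) \<longlonglongrightarrow> 1"
  proof (rule tendsto_sandwich)
    show "(\<lambda>i. 1 - (2 / (t * (real i - 2 * t)) + exp (- (real i * t / 2)))) \<longlonglongrightarrow> 1"
      using t by real_asymp
    have "\<forall>\<^sub>F i in sequentially. real i > 2 * t"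
      using t by real_asymp
    then show "\<forall>\<^sub>F i in sequentially. 1 - (2 / (t * (real i - 2 * t)) + exp (- (real i * t / 2)))
        \<le> (\<integral>z. cutoff_exp t (real i) z \<partial>\<nu>)"
      by eventually_elim (use lo in force)
    show "\<forall>\<^sub>F i in sequentially. (\<integral>z. cutoff_exp t (real i) z \<partial>\<nu>) \<le> 1"
      using up by simp
  qed simp
  have meas: "cutoff_exp t A \<in> borel_measurable \<nu>" for A
    by simp
  have "integrable \<nu> (\<lambda>z. exp (t * z - t\<^sup>2 / 2))" "(\<integral>z. exp (t * z - t\<^sup>2 / 2) \<partial>\<nu>) = 1"
  proof -
    have 1: "integrable \<nu> (cutoff_exp t (real i))" for i
      using cutoff_exp_bounded[OF t] meas by (intro \<nu>.integrable_const_bound[where B = "exp (t * (real i + 1))"]) auto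
    have 2: "AE z in \<nu>. mono (\<lambda>i. cutoff_exp t (real i) z)"
      by (intro AE_I2 monoI cutoff_exp_mono) simp
    have 3: "AE z in \<nu>. (\<lambda>i. cutoff_exp t (real i) z) \<longlonglongrightarrow> exp (t * z - t\<^sup>2 / 2)"
    proof (intro AE_I2 tendsto_eventually)
      fix z :: real
      have "\<forall>\<^sub>F i in sequentially. \<bar>z\<bar> \<le> real i"
        by real_asymp
      then show "\<forall>\<^sub>F i in sequentially. cutoff_exp t (real i) z = exp (t * z - t\<^sup>2 / 2)"
        by eventually_elim (rule cutoff_exp_eq)
    qed
    have 4: "AE z in \<nu>. 0 \<le> cutoff_exp t (real i) z" for i
      using cutoff_exp_bounds by simp
    have 5: "(\<lambda>z. exp (t * z - t\<^sup>2 / 2)) \<in> borel_measurable \<nu>"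
      by simp
    show "integrable \<nu> (\<lambda>z. exp (t * z - t\<^sup>2 / 2))" "(\<integral>z. exp (t * z - t\<^sup>2 / 2) \<partial>\<nu>) = 1"
      using integral_monotone_convergence_nonneg[OF 1 2 4 3 lim 5] by auto
  qed
  then have "has_bochner_integral \<nu> (\<lambda>z. exp (t\<^sup>2 / 2) * exp (t * z - t\<^sup>2 / 2)) (exp (t\<^sup>2 / 2) * 1)"
    by (intro has_bochner_integral_mult_right) (simp add: has_bochner_integral_iff)
  then show ?thesis
    by (simp flip: exp_add)
qed


text \<open>
  A special case of a criterion of Gao and Wormald. The second moments give tightness, and all subsequential
  limits are identified by \<open>positive_mgf_of_weak_limit\<close> and \<open>normal_unique_if_positive_mgf\<close>.
\<close>
theorem normal_limit_of_factorial_moments: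
  fixes P :: "nat \<Rightarrow> nat pmf" and s :: "nat \<Rightarrow> real"
  assumes fin: "\<And>k. finite (set_pmf (P k))"
    and s_pos: "\<And>k. s k > 0" and s_lim: "filterlim s at_top sequentially"
    and fm: "\<And>C e. e > 0 \<Longrightarrow> \<forall>\<^sub>F k in sequentially. \<forall>q. real q \<le> C * sqrt (s k) \<longrightarrow>
              \<bar>measure_pmf.expectation (P k) (scaled_ffact (s k) q) - 1\<bar> \<le> e"
    and var: "\<And>k. measure_pmf.expectation (P k) (\<lambda>x. (real x - s k)\<^sup>2) \<le> B * s k"
  shows "weak_conv_m (\<lambda>k. distr (P k) borel (\<lambda>x. (real x - s k) / sqrt (s k))) std_normal_distribution"
proof -
  define \<mu> where "\<mu> k = distr (P k) borel (\<lambda>x. (real x - s k) / sqrt (s k))" for k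
  have rd: "real_distribution (\<mu> k)" for k
    unfolding \<mu>_def by (rule prob_space.real_distribution_distr[OF prob_space_measure_pmf]) simp
  have int: "integrable (measure_pmf (P k)) f" for k and f :: "nat \<Rightarrow> real"
    by (rule integrable_measure_pmf_finite) (rule fin)
  have "tight \<mu>"
    unfolding tight_def
  proof (intro conjI allI impI)
    fix e :: real assume e: "e > 0"
    \<comment> \<open>Chosen so that Chebyshev's bound \<open>|B| / a\<^sup>2\<close> is below \<open>e\<close>.\<close>
    define a where "a = sqrt (2 * (\<bar>B\<bar> + 1) / e)"
    have a: "a > 0"
      using e by (simp add: a_def)
    have "a\<^sup>2 = 2 * (\<bar>B\<bar> + 1) / e"
      using e by (simp add: a_def)
    then have "\<bar>B\<bar> < e * a\<^sup>2"
      using e by simp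
    then have small: "\<bar>B\<bar> / a\<^sup>2 < e"
      using a by (simp add: pos_divide_less_eq)
    have "measure (\<mu> k) {- (2 * a)<..2 * a} > 1 - e" for k
    proof -
      interpret \<mu>: real_distribution "\<mu> k" by (rule rd)
      let ?Z = "\<lambda>x::nat. (real x - s k) / sqrt (s k)"
      have "measure (measure_pmf (P k)) {x \<in> space (measure_pmf (P k)). a\<^sup>2 \<le> (?Z x)\<^sup>2}
          \<le> measure_pmf.expectation (P k) (\<lambda>x. (?Z x)\<^sup>2) / a\<^sup>2"
        using a int by (intro integral_Markov_inequality_measure[where A = "{}"]) auto
      also have "measure_pmf.expectation (P k) (\<lambda>x. (?Z x)\<^sup>2)
          = measure_pmf.expectation (P k) (\<lambda>x. (real x - s k)\<^sup>2) / s k"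
        using s_pos[of k] by (simp add: power_divide)
      also have "\<dots> \<le> \<bar>B\<bar>"
        using var[of k] s_pos[of k] by (simp add: pos_divide_le_eq) (meson abs_ge_self mult_right_mono order_trans less_imp_le)
      also have "\<bar>B\<bar> / a\<^sup>2 < e" by (rule small)
      finally have "measure_pmf.prob (P k) {x. a\<^sup>2 \<le> (?Z x)\<^sup>2} < e"
        using a by (simp add: divide_right_mono)
      moreover have "measure_pmf.prob (P k) {x. ?Z x \<notin> {- (2 * a)<..2 * a}} \<le> measure_pmf.prob (P k) {x. a\<^sup>2 \<le> (?Z x)\<^sup>2}"
      proof (rule measure_pmf.finite_measure_mono)
        show "{x. ?Z x \<notin> {- (2 * a)<..2 * a}} \<subseteq> {x. a\<^sup>2 \<le> (?Z x)\<^sup>2}"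
        proof (rule Collect_mono, rule impI)
          fix x assume "?Z x \<notin> {- (2 * a)<..2 * a}"
          then have "\<bar>a\<bar> \<le> \<bar>?Z x\<bar>"
            using a by (auto simp del: abs_divide)
          then show "a\<^sup>2 \<le> (?Z x)\<^sup>2"
            by (rule abs_le_square_iff[THEN iffD1])
        qed
      qed simp
      moreover have "measure (\<mu> k) {- (2 * a)<..2 * a} = measure_pmf.prob (P k) {x. ?Z x \<in> {- (2 * a)<..2 * a}}"
        unfolding \<mu>_def by (subst measure_distr) (auto simp: vimage_def)
      moreover have "measure_pmf.prob (P k) {x. ?Z x \<in> {- (2 * a)<..2 * a}}
          = 1 - measure_pmf.prob (P k) {x. ?Z x \<notin> {- (2 * a)<..2 * a}}"
        using measure_pmf.prob_compl[of "{x. ?Z x \<notin> {- (2 * a)<..2 * a}}" "P k"] by (simp add: set_diff_eq)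
      ultimately show ?thesis by linarith
    qed
    then show "\<exists>a b. a < b \<and> (\<forall>n. 1 - e < measure (\<mu> n) {a<..b})"
      using a by (intro exI[of _ "- (2 * a)"] exI[of _ "2 * a"]) auto
  qed (rule rd)
  moreover have "weak_conv_m (\<mu> \<circ> r) std_normal_distribution"
    if r: "strict_mono r" and nu: "real_distribution \<nu>" and weak: "weak_conv_m (\<mu> \<circ> r) \<nu>" for r \<nu>
  proof -
    have "has_bochner_integral \<nu> (\<lambda>z. exp (t * z)) (exp (t\<^sup>2 / 2))" if "t > 0" for t
    proof (rule positive_mgf_of_weak_limit[where P = "\<lambda>k. P (r k)" and s = "\<lambda>k. s (r k)"])
      show "filterlim (\<lambda>k. s (r k)) at_top sequentially"
        by (rule filterlim_compose[OF s_lim filterlim_subseq[OF r]])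
      show "\<forall>\<^sub>F k in sequentially. \<forall>q. real q \<le> C * sqrt (s (r k)) \<longrightarrow>
              \<bar>measure_pmf.expectation (P (r k)) (scaled_ffact (s (r k)) q) - 1\<bar> \<le> e" if "e > 0" for C e
        by (rule eventually_subseq[OF r fm[OF that]])
      show "weak_conv_m (\<lambda>k. distr (P (r k)) borel (\<lambda>x. (real x - s (r k)) / sqrt (s (r k)))) \<nu>"
        using weak by (simp add: \<mu>_def comp_def)
    qed (use fin s_pos nu that in auto)
    then have "\<nu> = std_normal_distribution"
      by (rule normal_unique_if_positive_mgf[OF nu])
    then show ?thesis
      using weak by simp
  qed
  ultimately have "weak_conv_m \<mu> std_normal_distribution"
    by (intro tight_subseq_weak_converge[OF rd real_dist_normal_dist])
  then show ?thesis
    unfolding \<mu>_def[abs_def] .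
qed

section \<open>Limit laws for fringe tree counts\<close>

text \<open>
  Used to discard the index \<open>0\<close>, at which no degree statistic is assumed, and the indices at which the asymptotic
  bounds do not hold yet.
\<close>
lemma weak_conv_m_offset:
  assumes "weak_conv_m (\<lambda>k. \<mu> (k + c)) \<nu>"
  shows "weak_conv_m \<mu> \<nu>"
  using assms unfolding weak_conv_m_def weak_conv_def
  by (auto intro: LIMSEQ_offset)

lemma degree_statistic_imp_mset:
  assumes "degree_statistic n"
  obtains M where "count M = n" "size M = Suc (sum_mset M)"
proof
  let ?M = "Abs_multiset n"
  show count: "count ?M = n"
    using assms by (intro count_Abs_multiset) (simp add: degree_statistic_def)
  have set: "{i. n i > 0} = set_mset ?M"
    by (simp add: set_mset_def count)
  have "sum_mset ?M = (\<Sum>i | n i > 0. i * n i)"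
    using sum_mset_eq_sum[of "set_mset ?M" ?M] by (simp add: set count mult.commute)
  moreover have "size ?M = stat_size n"
    using stat_size_count[of ?M] by (simp add: count)
  ultimately show "size ?M = Suc (sum_mset ?M)"
    using assms by (simp add: degree_statistic_def)
qed

text \<open>
  A degree of \<open>T\<close> absent from \<open>n\<close> would put a factor \<open>0\<close> into \<open>\<pi>(T)\<close>.
\<close>
lemma degrees_subset_if_fringe_scale_pos:
  assumes "fringe_scale n T > 0"
  shows "degrees T \<subseteq> {i. n i > 0}"
proof
  fix i assume i: "i \<in> degrees T"
  have "tree_prob (emp_dist n) T \<noteq> 0"
    using assms by (auto simp: fringe_scale_def)
  then have "emp_dist n i ^ deg_stat T i \<noteq> 0"
    using i finite_degrees by (simp add: tree_prob_def)
  then show "i \<in> {i. n i > 0}"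
    using i by (auto simp: degrees_def emp_dist_def)
qed

text \<open>
  The hypothesis of the theorem in the form in which it enters the estimates. The normalisations \<open>|T|\<close> and \<open>|n|\<close> of the
  empirical distributions cancel.
\<close>
lemma smallness_eq:
  "real (tree_size T) ^ 2 * tree_prob (emp_dist n) T * (\<Sum>i\<in>degrees T. emp_dist (deg_stat T) i ^ 2 / emp_dist n i)
    = fringe_scale n T * rel_overlap n T"
proof -
  have D: "deg_stat T = count (degs T)"
    by (simp add: fun_eq_iff count_degs)
  have m: "real (tree_size T) > 0" "stat_size (deg_stat T) = tree_size T"
    by (simp_all add: D stat_size_count tree_size_eq size_degs del: of_nat_Suc)
  have "real (tree_size T) ^ 2 * (\<Sum>i\<in>degrees T. emp_dist (deg_stat T) i ^ 2 / emp_dist n i)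
      = (\<Sum>i\<in>degrees T. real (tree_size T) ^ 2 * (emp_dist (deg_stat T) i ^ 2 / emp_dist n i))"
    by (rule sum_distrib_left)
  also have "\<dots> = (\<Sum>i\<in>degrees T. real (stat_size n) * ((real (deg_stat T i))\<^sup>2 / real (n i)))"
    using m by (intro sum.cong refl) (simp add: emp_dist_def power_divide)
  also have "\<dots> = real (stat_size n) * rel_overlap n T"
    by (simp add: rel_overlap_def sum_distrib_left)
  finally have "tree_prob (emp_dist n) T * (real (tree_size T) ^ 2 * (\<Sum>i\<in>degrees T. emp_dist (deg_stat T) i ^ 2 / emp_dist n i))
      = tree_prob (emp_dist n) T * (real (stat_size n) * rel_overlap n T)"
    by simp
  then show ?thesis
    by (simp only: fringe_scale_def mult_ac)
qed

lemma finite_set_pmf_random_tree: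
  assumes "degree_statistic n"
  shows "finite (set_pmf (random_tree n))"
proof -
  obtain M where M: "count M = n" "size M = Suc (sum_mset M)"
    using degree_statistic_imp_mset[OF assms] .
  show ?thesis
    unfolding random_tree_def using trees_with_finite_nonempty[OF M(2)] by (simp add: M(1))
qed

lemma scaled_ffact_1: "scaled_ffact s 1 x = real x / s"
  by (simp add: scaled_ffact_def)

lemma scaled_ffact_2: "scaled_ffact s 2 x = real x * (real x - 1) / s\<^sup>2"
  by (simp add: scaled_ffact_eq_prod numeral_2_eq_2)

text \<open>
  The two regimes share the assumption that the scale stays bounded away from \<open>0\<close>. It turns
  \<open>s \<epsilon> \<rightarrow> 0\<close> into \<open>\<epsilon> \<rightarrow> 0\<close>, and it makes the degrees of \<open>T k\<close> available in \<open>n k\<close>.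
\<close>
locale fringe_sequence =
  fixes n :: "nat \<Rightarrow> nat \<Rightarrow> nat" and T :: "nat \<Rightarrow> plane_tree" and c :: real
  assumes stat: "\<And>k. k \<ge> 1 \<Longrightarrow> degree_statistic (n k)"
    and small: "(\<lambda>k. real (tree_size (T k)) ^ 2 * tree_prob (emp_dist (n k)) (T k) *
        (\<Sum>i\<in>degrees (T k). emp_dist (deg_stat (T k)) i ^ 2 / emp_dist (n k) i))
      \<in> o[sequentially](\<lambda>_. 1)"
    and c: "c > 0" and scale_ge: "\<forall>\<^sub>F k in sequentially. fringe_scale (n k) (T k) \<ge> c"
begin

abbreviation "s k \<equiv> fringe_scale (n k) (T k)"
abbreviation "X k t \<equiv> real (fringe_count (T k) t)"
abbreviation "Expec k \<equiv> measure_pmf.expectation (random_tree (n k))"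
definition "eps k = rel_overlap (n k) (T k)"
definition "scaled_moment k q = Expec k (\<lambda>t. scaled_ffact (s k) q (fringe_count (T k) t))"

lemma integrable_random_tree: "k \<ge> 1 \<Longrightarrow> integrable (measure_pmf (random_tree (n k))) f" for f :: "plane_tree \<Rightarrow> real"
  by (intro integrable_measure_pmf_finite finite_set_pmf_random_tree stat)

lemma eventually_scale_pos: "\<forall>\<^sub>F k in sequentially. k \<ge> 1 \<and> s k \<ge> c \<and> s k > 0"
  using scale_ge eventually_ge_at_top[of 1] by eventually_elim (use c in auto)

lemma eps_nonneg: "eps k \<ge> 0"
  by (simp add: eps_def rel_overlap_nonneg)

lemma scaled_moment_bound:
  assumes k: "k \<ge> 1" "s k > 0" and q: "(real q)\<^sup>2 * eps k \<le> 1 / 2"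
  shows "\<bar>scaled_moment k q - 1\<bar> \<le> 2 * ((real q)\<^sup>2 * eps k)"
proof -
  obtain M where M: "count M = n k" "size M = Suc (sum_mset M)"
    using degree_statistic_imp_mset[OF stat[OF k(1)]] .
  have "set_mset (degs (T k)) \<subseteq> set_mset M"
    using degrees_subset_if_fringe_scale_pos[OF k(2)] unfolding degrees_eq by (auto simp: M(1)[symmetric])
  then show ?thesis
    using scaled_factorial_moment_bounds[OF M(2), of "T k" q] q by (simp add: M(1) scaled_moment_def eps_def)
qed

lemma scale_times_eps_lim: "(\<lambda>k. s k * eps k) \<longlonglongrightarrow> 0"
  using smalloD_tendsto[OF small] by (simp add: smallness_eq eps_def)

lemma eps_lim: "eps \<longlonglongrightarrow> 0"
proof (rule tendsto_sandwich[where f = "\<lambda>_. 0" and h = "\<lambda>k. s k * eps k / c"])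
  show "\<forall>\<^sub>F k in sequentially. eps k \<le> s k * eps k / c"
    using eventually_scale_pos
  proof eventually_elim
    case (elim k)
    then have "c * eps k \<le> s k * eps k"
      by (intro mult_right_mono eps_nonneg) simp
    then show ?case
      using c by (simp add: pos_le_divide_eq mult.commute)
  qed
  show "(\<lambda>k. s k * eps k / c) \<longlonglongrightarrow> 0"
    using tendsto_divide_zero[OF scale_times_eps_lim] .
qed (simp_all add: eps_nonneg)

text \<open>
  For \<open>q \<le> C \<surd>s\<close> the error bound \<open>2 q\<^sup>2 \<epsilon>\<close> is at most \<open>2 C\<^sup>2 s \<epsilon>\<close>.
\<close>
lemma scaled_moment_uniform:
  assumes "e > 0"
  shows "\<forall>\<^sub>F k in sequentially. \<forall>q. real q \<le> C * sqrt (s k) \<longrightarrow> \<bar>scaled_moment k q - 1\<bar> \<le> e"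
proof -
  have "(\<lambda>k. C\<^sup>2 * (s k * eps k)) \<longlonglongrightarrow> 0"
    using tendsto_mult_right_zero[OF scale_times_eps_lim] .
  then have "\<forall>\<^sub>F k in sequentially. C\<^sup>2 * (s k * eps k) < min (1 / 2) (e / 2)"
    using assms by (intro order_tendstoD(2)) auto
  then show ?thesis
    using eventually_scale_pos
  proof eventually_elim
    case (elim k)
    show ?case
    proof (intro allI impI)
      fix q assume q: "real q \<le> C * sqrt (s k)"
      have "(real q)\<^sup>2 \<le> (C * sqrt (s k))\<^sup>2"
        using q by (intro power_mono) auto
      also have "\<dots> = C\<^sup>2 * s k"
        using elim by (simp add: power_mult_distrib)
      finally have "(real q)\<^sup>2 * eps k \<le> C\<^sup>2 * s k * eps k"
        by (intro mult_right_mono eps_nonneg)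
      then have "(real q)\<^sup>2 * eps k \<le> min (1 / 2) (e / 2)"
        using elim by (simp add: mult.assoc)
      then show "\<bar>scaled_moment k q - 1\<bar> \<le> e"
        using scaled_moment_bound[of k q] elim by simp
    qed
  qed
qed

lemma scaled_moment_error_eventually: "\<forall>\<^sub>F k in sequentially. \<bar>scaled_moment k q - 1\<bar> \<le> 2 * (real q)\<^sup>2 * eps k"
proof -
  have "(\<lambda>k. (real q)\<^sup>2 * eps k) \<longlonglongrightarrow> 0"
    using tendsto_mult_right_zero[OF eps_lim] .
  then have "\<forall>\<^sub>F k in sequentially. (real q)\<^sup>2 * eps k < 1 / 2"
    by (intro order_tendstoD(2)) auto
  then show ?thesis
    using eventually_scale_pos by eventually_elim (use scaled_moment_bound in \<open>simp add: mult.assoc\<close>)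
qed

text \<open>
  The error \<open>o(1 / s)\<close> for fixed \<open>q\<close>; this precision survives the cancellation in the variance.
\<close>
lemma scale_times_moment_error_lim: "(\<lambda>k. s k * (scaled_moment k q - 1)) \<longlonglongrightarrow> 0"
proof (rule Lim_null_comparison)
  show "\<forall>\<^sub>F k in sequentially. norm (s k * (scaled_moment k q - 1)) \<le> 2 * (real q)\<^sup>2 * (s k * eps k)"
    using eventually_scale_pos scaled_moment_error_eventually[of q]
  proof eventually_elim
    case (elim k)
    then have "s k * \<bar>scaled_moment k q - 1\<bar> \<le> s k * (2 * (real q)\<^sup>2 * eps k)"
      by (intro mult_left_mono) auto
    then show ?case
      using elim by (simp add: abs_mult mult_ac)
  qed
  show "(\<lambda>k. 2 * (real q)\<^sup>2 * (s k * eps k)) \<longlonglongrightarrow> 0"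
    using tendsto_mult_right_zero[OF scale_times_eps_lim] .
qed

lemma scaled_moment_lim: "(\<lambda>k. scaled_moment k q) \<longlonglongrightarrow> 1"
proof (rule LIM_zero_cancel, rule Lim_null_comparison)
  show "\<forall>\<^sub>F k in sequentially. norm (scaled_moment k q - 1) \<le> 2 * (real q)\<^sup>2 * eps k"
    using scaled_moment_error_eventually[of q] by simp
  show "(\<lambda>k. 2 * (real q)\<^sup>2 * eps k) \<longlonglongrightarrow> 0"
    using tendsto_mult_right_zero[OF eps_lim] .
qed

lemma mean_eq: "s k > 0 \<Longrightarrow> Expec k (X k) = s k * scaled_moment k 1"
  by (simp add: scaled_moment_def scaled_ffact_1[unfolded One_nat_def])

text \<open>
  The leading terms of the factorial moments of order \<open>1\<close> and \<open>2\<close> cancel, leaving \<open>s\<close> times a quantity that tends to \<open>1\<close>.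
\<close>
lemma second_moment_about_scale:
  assumes "k \<ge> 1" "s k > 0"
  shows "Expec k (\<lambda>t. (X k t - s k)\<^sup>2) = s k * (s k * (scaled_moment k 2 - 1) - 2 * (s k * (scaled_moment k 1 - 1)) + scaled_moment k 1)"
proof -
  have "(X k t - s k)\<^sup>2 = (s k)\<^sup>2 * scaled_ffact (s k) 2 (fringe_count (T k) t)
      + (s k - 2 * (s k)\<^sup>2) * scaled_ffact (s k) 1 (fringe_count (T k) t) + (s k)\<^sup>2" for t
    using assms by (simp only: scaled_ffact_1 scaled_ffact_2) (simp add: field_simps power2_eq_square)
  then have "Expec k (\<lambda>t. (X k t - s k)\<^sup>2) = (s k)\<^sup>2 * scaled_moment k 2 + (s k - 2 * (s k)\<^sup>2) * scaled_moment k 1 + (s k)\<^sup>2"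
    by (simp add: scaled_moment_def integrable_random_tree[OF assms(1)])
  then show ?thesis
    by (simp add: power2_eq_square algebra_simps)
qed

lemma second_moment_lim: "(\<lambda>k. Expec k (\<lambda>t. (X k t - s k)\<^sup>2) / s k) \<longlonglongrightarrow> 1"
proof (rule Lim_transform_eventually)
  have "(\<lambda>k. s k * (scaled_moment k 2 - 1) - 2 * (s k * (scaled_moment k 1 - 1)) + scaled_moment k 1) \<longlonglongrightarrow> 0 - 2 * 0 + 1"
    by (intro tendsto_intros scale_times_moment_error_lim scaled_moment_lim)
  then show "(\<lambda>k. s k * (scaled_moment k 2 - 1) - 2 * (s k * (scaled_moment k 1 - 1)) + scaled_moment k 1) \<longlonglongrightarrow> 1"
    by simp
  show "\<forall>\<^sub>F k in sequentially. s k * (scaled_moment k 2 - 1) - 2 * (s k * (scaled_moment k 1 - 1)) + scaled_moment k 1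
      = Expec k (\<lambda>t. (X k t - s k)\<^sup>2) / s k"
    using eventually_scale_pos by eventually_elim (simp add: second_moment_about_scale)
qed

lemma variance_eq:
  assumes "k \<ge> 1" "s k > 0"
  shows "measure_pmf.variance (random_tree (n k)) (X k)
    = Expec k (\<lambda>t. (X k t - s k)\<^sup>2) - (s k * (scaled_moment k 1 - 1))\<^sup>2"
proof -
  have "Expec k (\<lambda>t. (X k t - s k)\<^sup>2) = Expec k (\<lambda>t. (X k t)\<^sup>2) - 2 * s k * Expec k (X k) + (s k)\<^sup>2"
    by (simp add: power2_diff integrable_random_tree[OF assms(1)] mult.commute)
  moreover have "measure_pmf.variance (random_tree (n k)) (X k) = Expec k (\<lambda>t. (X k t)\<^sup>2) - (Expec k (X k))\<^sup>2"
    by (rule measure_pmf.variance_eq) (intro integrable_random_tree assms(1))+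
  ultimately show ?thesis
    unfolding mean_eq[OF assms(2)] by (simp add: power2_eq_square algebra_simps)
qed

lemma variance_lim: "(\<lambda>k. measure_pmf.variance (random_tree (n k)) (X k) / s k) \<longlonglongrightarrow> 1"
proof (rule Lim_transform_eventually)
  have "(\<lambda>k. Expec k (\<lambda>t. (X k t - s k)\<^sup>2) / s k - s k * (scaled_moment k 1 - 1) * (scaled_moment k 1 - 1)) \<longlonglongrightarrow> 1 - 0 * (1 - 1)"
    by (intro tendsto_intros scale_times_moment_error_lim scaled_moment_lim second_moment_lim)
  then show "(\<lambda>k. Expec k (\<lambda>t. (X k t - s k)\<^sup>2) / s k - s k * (scaled_moment k 1 - 1) * (scaled_moment k 1 - 1)) \<longlonglongrightarrow> 1"
    by simp
  show "\<forall>\<^sub>F k in sequentially. Expec k (\<lambda>t. (X k t - s k)\<^sup>2) / s k - s k * (scaled_moment k 1 - 1) * (scaled_moment k 1 - 1)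
      = measure_pmf.variance (random_tree (n k)) (X k) / s k"
    using eventually_scale_pos
  proof eventually_elim
    case (elim k)
    have "a / b - b * g * g = (a - (b * g)\<^sup>2) / b" if "b > 0" for a b g :: real
      using that by (simp add: field_simps power2_eq_square)
    then show ?case
      using elim by (simp only: variance_eq)
  qed
qed

lemma mean_lim: "(\<lambda>k. Expec k (X k) / s k) \<longlonglongrightarrow> 1"
  by (rule Lim_transform_eventually[OF scaled_moment_lim[of 1]]) (use eventually_scale_pos in \<open>eventually_elim, simp add: mean_eq\<close>)

lemma asymp_equivs:
  shows "(\<lambda>k. Expec k (X k)) \<sim>[sequentially] (\<lambda>k. measure_pmf.variance (random_tree (n k)) (X k))"
    and "(\<lambda>k. measure_pmf.variance (random_tree (n k)) (X k)) \<sim>[sequentially] s"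
proof -
  show var: "(\<lambda>k. measure_pmf.variance (random_tree (n k)) (X k)) \<sim>[sequentially] s"
    by (rule asymp_equivI'[OF variance_lim])
  have "(\<lambda>k. Expec k (X k)) \<sim>[sequentially] s"
    by (rule asymp_equivI'[OF mean_lim])
  also have "s \<sim>[sequentially] (\<lambda>k. measure_pmf.variance (random_tree (n k)) (X k))"
    by (rule asymp_equiv_symI[OF var])
  finally show "(\<lambda>k. Expec k (X k)) \<sim>[sequentially] (\<lambda>k. measure_pmf.variance (random_tree (n k)) (X k))" .
qed

lemma poisson_moments:
  assumes l: "l > 0" and lim: "s \<longlonglongrightarrow> l"
  shows "(\<lambda>k. Expec k (\<lambda>t. X k t ^ r)) \<longlonglongrightarrow> measure_pmf.expectation (poisson_pmf l) (\<lambda>x. real x ^ r)"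
proof -
  obtain a where a: "\<And>x. real x ^ r = (\<Sum>j\<le>r. a j * (fact j * real (x choose j)))"
    using power_eq_sum_factorial_binomials[of r] by blast
  have "(\<lambda>k. \<Sum>j\<le>r. a j * (s k ^ j * scaled_moment k j)) \<longlonglongrightarrow> (\<Sum>j\<le>r. a j * (l ^ j * 1))"
    by (intro tendsto_intros lim scaled_moment_lim)
  moreover have "\<forall>\<^sub>F k in sequentially. (\<Sum>j\<le>r. a j * (s k ^ j * scaled_moment k j)) = Expec k (\<lambda>t. X k t ^ r)"
    using eventually_scale_pos
  proof eventually_elim
    case (elim k)
    have "s k ^ j * scaled_moment k j = Expec k (\<lambda>t. fact j * real (fringe_count (T k) t choose j))" for j
      using elim by (simp add: scaled_moment_def scaled_ffact_def)
    moreover have "Expec k (\<lambda>t. X k t ^ r) = (\<Sum>j\<le>r. a j * Expec k (\<lambda>t. fact j * real (fringe_count (T k) t choose j)))"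
      unfolding a using elim integrable_random_tree[of k] by (subst Bochner_Integration.integral_sum) auto
    ultimately show ?case by simp
  qed
  moreover have "measure_pmf.expectation (poisson_pmf l) (\<lambda>x. real x ^ r) = (\<Sum>j\<le>r. a j * (l ^ j * 1))"
  proof -
    have P: "integrable (measure_pmf (poisson_pmf l)) (\<lambda>x. fact j * real (x choose j))"
      "measure_pmf.expectation (poisson_pmf l) (\<lambda>x. fact j * real (x choose j)) = l ^ j" for j
      using poisson_factorial_moment[OF l, of j] by (auto simp only: has_bochner_integral_iff)
    have "measure_pmf.expectation (poisson_pmf l) (\<lambda>x. real x ^ r)
        = (\<Sum>j\<le>r. measure_pmf.expectation (poisson_pmf l) (\<lambda>x. a j * (fact j * real (x choose j))))"
      unfolding a by (intro Bochner_Integration.integral_sum integrable_mult_right P)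
    also have "\<dots> = (\<Sum>j\<le>r. a j * (l ^ j * 1))"
      by (intro sum.cong refl, subst integral_mult_right_zero) (simp only: P(2) mult_1_right)
    finally show ?thesis .
  qed
  ultimately show ?thesis
    by (simp only: Lim_transform_eventually)
qed

lemma poisson_weak_limit:
  assumes l: "l > 0" and lim: "s \<longlonglongrightarrow> l"
  shows "weak_conv_m (\<lambda>k. distr (random_tree (n k)) borel (X k)) (distr (poisson_pmf l) borel real)"
proof (rule weak_conv_m_offset[where c = 1], rule levy_continuity)
  let ?\<mu> = "\<lambda>k. distr (random_tree (n (k + 1))) borel (X (k + 1))" and ?\<nu> = "distr (poisson_pmf l) borel real"
  show rd: "real_distribution (?\<mu> k)" "real_distribution ?\<nu>" for k
    by (rule prob_space.real_distribution_distr[OF prob_space_measure_pmf]; simp)+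
  show "(\<lambda>k. char (?\<mu> k) t) \<longlonglongrightarrow> char ?\<nu> t" for t
  proof (rule moments_converge_imp_char_converges[OF rd])
    show "integrable (?\<mu> k) (\<lambda>x. x ^ r)" for k r
      by (subst integrable_distr_eq) (auto intro!: integrable_random_tree)
    show "(\<lambda>k. \<integral>x. x ^ r \<partial>?\<mu> k) \<longlonglongrightarrow> (\<integral>x. x ^ r \<partial>?\<nu>)" for r
      using LIMSEQ_ignore_initial_segment[OF poisson_moments[OF assms, of r], of 1]
      by (simp add: integral_distr)
    show "integrable ?\<nu> (\<lambda>x. exp (a * x))" for a
      using poisson_mgf[OF l, of a] by (subst integrable_distr_eq) (auto simp: has_bochner_integral_iff)
  qed
qed

lemma normal_weak_limit:
  assumes lim: "filterlim s at_top sequentially"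
  shows "weak_conv_m (\<lambda>k. distr (random_tree (n k)) borel (\<lambda>t. (X k t - s k) / sqrt (s k))) std_normal_distribution"
proof -
  have "\<forall>\<^sub>F k in sequentially. Expec k (\<lambda>t. (X k t - s k)\<^sup>2) / s k < 2"
    using second_moment_lim by (intro order_tendstoD(2)) auto
  then have "\<forall>\<^sub>F k in sequentially. k \<ge> 1 \<and> s k > 0 \<and> Expec k (\<lambda>t. (X k t - s k)\<^sup>2) \<le> 2 * s k"
    using eventually_scale_pos by eventually_elim (simp add: pos_divide_less_eq)
  then obtain k0 where k0: "\<And>k. k \<ge> k0 \<Longrightarrow> k \<ge> 1 \<and> s k > 0 \<and> Expec k (\<lambda>t. (X k t - s k)\<^sup>2) \<le> 2 * s k"
    unfolding eventually_sequentially by blast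
  define P where "P k = map_pmf (fringe_count (T (k + k0))) (random_tree (n (k + k0)))" for k
  have "weak_conv_m (\<lambda>k. distr (P k) borel (\<lambda>x. (real x - s (k + k0)) / sqrt (s (k + k0)))) std_normal_distribution"
  proof (rule normal_limit_of_factorial_moments[where B = 2])
    show "finite (set_pmf (P k))" for k
      using k0[of "k + k0"] by (simp add: P_def finite_set_pmf_random_tree stat)
    show "s (k + k0) > 0" for k
      using k0[of "k + k0"] by simp
    show "filterlim (\<lambda>k. s (k + k0)) at_top sequentially"
      by (rule filterlim_compose[OF lim]) (simp add: filterlim_add_const_nat_at_top)
    show "\<forall>\<^sub>F k in sequentially. \<forall>q. real q \<le> C * sqrt (s (k + k0)) \<longrightarrow>
        \<bar>measure_pmf.expectation (P k) (scaled_ffact (s (k + k0)) q) - 1\<bar> \<le> e" if "e > 0" for C e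
      using sequentially_offset[OF scaled_moment_uniform[OF that, of C], of k0]
      by (simp add: P_def scaled_moment_def)
    show "measure_pmf.expectation (P k) (\<lambda>x. (real x - s (k + k0))\<^sup>2) \<le> 2 * s (k + k0)" for k
      using k0[of "k + k0"] by (simp add: P_def)
  qed
  also have "(\<lambda>k. distr (P k) borel (\<lambda>x. (real x - s (k + k0)) / sqrt (s (k + k0))))
      = (\<lambda>k. distr (random_tree (n (k + k0))) borel (\<lambda>t. (X (k + k0) t - s (k + k0)) / sqrt (s (k + k0))))"
    unfolding P_def map_pmf_rep_eq by (subst distr_distr) (auto simp: comp_def)
  finally show ?thesis
    by (rule weak_conv_m_offset)
qed

lemma standardized_mean_lim:
  assumes lim: "filterlim s at_top sequentially"
  shows "(\<lambda>k. Expec k (\<lambda>t. (X k t - s k) / sqrt (s k))) \<longlonglongrightarrow> 0"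
proof (rule Lim_transform_eventually)
  have "filterlim (\<lambda>k. sqrt (s k)) at_top sequentially"
    by (rule filterlim_compose[OF sqrt_at_top lim])
  then show "(\<lambda>k. (s k * (scaled_moment k 1 - 1)) / sqrt (s k)) \<longlonglongrightarrow> 0"
    by (intro real_tendsto_divide_at_top[OF scale_times_moment_error_lim])
  show "\<forall>\<^sub>F k in sequentially. (s k * (scaled_moment k 1 - 1)) / sqrt (s k) = Expec k (\<lambda>t. (X k t - s k) / sqrt (s k))"
    using eventually_scale_pos
  proof eventually_elim
    case (elim k)
    have "Expec k (\<lambda>t. (X k t - s k) / sqrt (s k)) = (Expec k (X k) - s k) / sqrt (s k)"
      using elim integrable_random_tree[of k] by (simp add: diff_divide_distrib)
    then show ?case
      using elim by (simp add: mean_eq right_diff_distrib)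
  qed
qed

lemma standardized_variance_lim:
  "(\<lambda>k. measure_pmf.variance (random_tree (n k)) (\<lambda>t. (X k t - s k) / sqrt (s k))) \<longlonglongrightarrow> 1"
proof (rule Lim_transform_eventually[OF variance_lim])
  show "\<forall>\<^sub>F k in sequentially. measure_pmf.variance (random_tree (n k)) (X k) / s k
      = measure_pmf.variance (random_tree (n k)) (\<lambda>t. (X k t - s k) / sqrt (s k))"
    using eventually_scale_pos
  proof eventually_elim
    case (elim k)
    have "Expec k (\<lambda>t. (X k t - s k) / sqrt (s k)) = (Expec k (X k) - s k) / sqrt (s k)"
      using elim integrable_random_tree[of k] by (simp add: diff_divide_distrib)
    then have "((X k t - s k) / sqrt (s k) - Expec k (\<lambda>t. (X k t - s k) / sqrt (s k)))\<^sup>2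
        = (X k t - Expec k (X k))\<^sup>2 / s k" for t
      using elim by (simp add: power_divide flip: diff_divide_distrib)
    then show ?case
      by simp
  qed
qed

end

theorem theorem3p3:
  fixes n :: "nat \<Rightarrow> nat \<Rightarrow> nat" and p :: "nat pmf" and T :: "nat \<Rightarrow> plane_tree"
  assumes stat: "\<And>k. k \<ge> 1 \<Longrightarrow> degree_statistic (n k)"
    and size: "filterlim (\<lambda>k. stat_size (n k)) at_top sequentially"
    and lim: "\<And>i. (\<lambda>k. emp_dist (n k) i) \<longlonglongrightarrow> pmf p i"
    and small: "(\<lambda>k. real (tree_size (T k)) ^ 2 * tree_prob (emp_dist (n k)) (T k) *
        (\<Sum>i\<in>degrees (T k). emp_dist (deg_stat (T k)) i ^ 2 / emp_dist (n k) i))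
      \<in> o[sequentially](\<lambda>_. 1)"
  shows
    "(\<forall>l::real>0. (\<lambda>k. fringe_scale (n k) (T k)) \<longlonglongrightarrow> l \<longrightarrow>
        weak_conv_m
          (\<lambda>k. distr (random_tree (n k)) borel (\<lambda>t. real (fringe_count (T k) t)))
          (distr (poisson_pmf l) borel real) \<and>
        (\<forall>r::nat. (\<lambda>k. measure_pmf.expectation (random_tree (n k))
                       (\<lambda>t. real (fringe_count (T k) t) ^ r))
              \<longlonglongrightarrow> measure_pmf.expectation (poisson_pmf l) (\<lambda>x. real x ^ r)))
     \<and>
     (filterlim (\<lambda>k. fringe_scale (n k) (T k)) at_top sequentially \<longrightarrow>
        weak_conv_m
          (\<lambda>k. distr (random_tree (n k)) borel
             (\<lambda>t. (real (fringe_count (T k) t) - fringe_scale (n k) (T k)) / sqrt (fringe_scale (n k) (T k))))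
          std_normal_distribution \<and>
        (\<lambda>k. measure_pmf.expectation (random_tree (n k))
             (\<lambda>t. (real (fringe_count (T k) t) - fringe_scale (n k) (T k)) / sqrt (fringe_scale (n k) (T k))))
          \<longlonglongrightarrow> 0 \<and>
        (\<lambda>k. measure_pmf.variance (random_tree (n k))
             (\<lambda>t. (real (fringe_count (T k) t) - fringe_scale (n k) (T k)) / sqrt (fringe_scale (n k) (T k))))
          \<longlonglongrightarrow> 1)
     \<and>
     ((\<exists>l::real>0. (\<lambda>k. fringe_scale (n k) (T k)) \<longlonglongrightarrow> l) \<or>
      filterlim (\<lambda>k. fringe_scale (n k) (T k)) at_top sequentially \<longrightarrow>
        (\<lambda>k. measure_pmf.expectation (random_tree (n k)) (\<lambda>t. real (fringe_count (T k) t)))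
          \<sim>[sequentially]
        (\<lambda>k. measure_pmf.variance (random_tree (n k)) (\<lambda>t. real (fringe_count (T k) t))) \<and>
        (\<lambda>k. measure_pmf.variance (random_tree (n k)) (\<lambda>t. real (fringe_count (T k) t)))
          \<sim>[sequentially]
        (\<lambda>k. fringe_scale (n k) (T k)))"
proof -
  let ?s = "\<lambda>k. fringe_scale (n k) (T k)"
  have poisson: "fringe_sequence n T (l / 2)" if l: "l > 0" "?s \<longlonglongrightarrow> l" for l
  proof
    have "\<forall>\<^sub>F k in sequentially. ?s k > l / 2"
      using l by (intro order_tendstoD(1)) auto
    then show "\<forall>\<^sub>F k in sequentially. l / 2 \<le> ?s k"
      by eventually_elim simp
  qed (use stat small l in auto)
  have normal: "fringe_sequence n T 1" if inf: "filterlim ?s at_top sequentially"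
  proof
    show "\<forall>\<^sub>F k in sequentially. 1 \<le> ?s k"
      using inf by (simp add: filterlim_at_top)
  qed (use stat small in auto)
  show ?thesis
  proof (intro conjI allI impI)
    fix l r assume l: "l > (0::real)" "?s \<longlonglongrightarrow> l"
    show "weak_conv_m (\<lambda>k. distr (random_tree (n k)) borel (\<lambda>t. real (fringe_count (T k) t)))
          (distr (poisson_pmf l) borel real)"
      by (rule fringe_sequence.poisson_weak_limit[OF poisson[OF l] l])
    show "(\<lambda>k. measure_pmf.expectation (random_tree (n k)) (\<lambda>t. real (fringe_count (T k) t) ^ r))
              \<longlonglongrightarrow> measure_pmf.expectation (poisson_pmf l) (\<lambda>x. real x ^ r)"
      by (rule fringe_sequence.poisson_moments[OF poisson[OF l] l])
  next
    assume inf: "filterlim ?s at_top sequentially"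
    interpret fringe_sequence n T 1 by (rule normal[OF inf])
    note normal_weak_limit[OF inf] standardized_mean_lim[OF inf] standardized_variance_lim
    then show "weak_conv_m
          (\<lambda>k. distr (random_tree (n k)) borel
             (\<lambda>t. (real (fringe_count (T k) t) - fringe_scale (n k) (T k)) / sqrt (fringe_scale (n k) (T k))))
          std_normal_distribution"
      "(\<lambda>k. measure_pmf.expectation (random_tree (n k))
             (\<lambda>t. (real (fringe_count (T k) t) - fringe_scale (n k) (T k)) / sqrt (fringe_scale (n k) (T k))))
          \<longlonglongrightarrow> 0"
      "(\<lambda>k. measure_pmf.variance (random_tree (n k))
             (\<lambda>t. (real (fringe_count (T k) t) - fringe_scale (n k) (T k)) / sqrt (fringe_scale (n k) (T k))))
          \<longlonglongrightarrow> 1"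
      by blast+
  next
    assume "(\<exists>l>0. ?s \<longlonglongrightarrow> l) \<or> filterlim ?s at_top sequentially"
    then obtain c where "fringe_sequence n T c"
      using poisson normal by blast
    then interpret fringe_sequence n T c .
    show "(\<lambda>k. measure_pmf.expectation (random_tree (n k)) (\<lambda>t. real (fringe_count (T k) t)))
          \<sim>[sequentially]
        (\<lambda>k. measure_pmf.variance (random_tree (n k)) (\<lambda>t. real (fringe_count (T k) t)))"
      and "(\<lambda>k. measure_pmf.variance (random_tree (n k)) (\<lambda>t. real (fringe_count (T k) t)))
          \<sim>[sequentially] ?s"
      by (rule asymp_equivs)+
  qed
qed

end
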